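(* Suppose $v\in\mathcal{C}^{1,1}(\mathcal{D})$ is a bounded function that satisfies the following conditions: (i) $\lim_{m\to\infty}v(m,m)\ge0$. (ii) $v(x,m)$ is defined for all $x\le m$ and $m\ge0$, with $v(x,m)=1$ for all $x<\alpha m$. (iii) $v_m(m,m)\le0$ for all $m\ge0$. (iv) $\mathcal{L}^{\hat R}v(x,m)\le0$ for all $(x,m)\in\mathcal{D}$ and for some admissible retention function $\hat R$. Then $\psi\le v$ on $\mathcal{D}$.
   Context: Market. $Y$ is a random variable (claim size) with c.d.f. $F_Y$, $F_Y(0)=0$, and moment generating function finite in a neighborhood of $0$. Constants: $\alpha\in[0,1)$, $\lambda>0$, $\theta\ge0$, $\eta\ge0$, and $c$ with $\lambda\mathbb{E}Y<c<(1+\theta)\lambda\mathbb{E}Y+\frac{\eta}{2}\lambda\mathbb{E}(Y^2)$; set $\kappa=(1+\theta)\lambda\mathbb{E}Y+\frac{\eta}{2}\lambda\mathbb{E}(Y^2)-c>0$. For a Borel function $R$ write $\mathbb{E}R=\mathbb{E}[R(Y)]$, $\mathbb{E}(YR)=\mathbb{E}[YR(Y)]$, etc. The domain is $\mathcal{D}=\{(x,m)\in\mathbb{R}_+^2:\alpha m\le x\le m\}$. An admissible retention function is a Borel function $R:\mathbb{R}_+\to\mathbb{R}_+$ with $0\le R(y)\le y$ for all $y\ge0$ and $c-(1+\theta)\lambda\mathbb{E}(Y-R)-\frac{\eta}{2}\lambda\mathbb{E}((Y-R)^2)>\lambda\mathbb{E}R$. Controlled surplus. On a filtered probability space $(\Omega,\mathcal{F},\{\mathcal{F}_t\}_{t\ge0},\mathbb{P})$,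 claims arrive at the jump times of a Poisson process $N$ of rate $\lambda$ with i.i.d. sizes distributed as $Y$, independent of $N$ (the claim process being a compound Poisson process relative to the filtration). An admissible retention strategy is a family $\mathcal{R}=\{R_t(\omega,y)\}_{t\ge0}$ such that: $(\omega,y)\mapsto R_t(\omega,y)$ is $\mathcal{F}_{t^-}\times\mathcal{B}(\mathbb{R}_+)$-measurable for each $t$; it is progressively measurable; $0\le R_t(\omega,y)\le y$; and, with probability one for all $t\ge0$, $c-(1+\theta)\lambda\mathbb{E}(Y-R_t)-\frac{\eta}{2}\lambda\mathbb{E}((Y-R_t)^2)>\lambda\mathbb{E}R_t$, expectations being over the claim size only ($\omega,t$ fixed). The surplus starts at $X_0=x$ and satisfies $$dX_t=\Big(c-(1+\theta)\lambda\mathbb{E}(Y-R_t)-\tfrac{\eta}{2}\lambda\mathbb{E}((Y-R_t)^2)\Big)dt-R_t\,dN_t,$$ i.e. when a claim of size $y$ occurs at time $t$ the surplus drops by $R_t(\omega,y)$. The running maximum is $M_t=\max\{\sup_{0\le s\le t}X_s,\,m\}$ with $m\ge x$; the drawdown time is $\tau_\alpha=\inf\{t\ge0:X_t<\alpha M_t\}$. The minimum probability of drawdown is $\psi(x,m)=\inf_{\mathcal{R}}\mathbb{P}^{x,m}(\tau_\alpha<\infty)$, the infimum over admissible strategies. $\mathcal{C}^{1,1}(\mathcal{D})$ denotes functions on $\mathcal{D}$ that are continuously differentiable in $x$ and in $m$. For an admissible retention function $R$ and $v\in\mathcal{C}^{1,1}(\mathcal{D})$, extended by $v(x,m)=1$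 for $x<\alpha m$, $$\mathcal{L}^Rv(x,m)=-\kappa v_x(x,m)+\lambda\Big[\Big((1+\theta)\mathbb{E}R+\eta\mathbb{E}(YR)-\tfrac{\eta}{2}\mathbb{E}(R^2)\Big)v_x(x,m)+\mathbb{E}v(x-R,m)-v(x,m)\Big].$$ *)

theory Defs
  imports "HOL-Probability.Probability"
begin

subsection \<open>Claim sizes and retention\<close>

text \<open>The claim size enters only through its law \<open>\<nu>\<close>.  Retention functions are relevant on
  the half line only, so expectations over the claim size are set integrals over \<open>{0..}\<close>: values
  (and possible non-measurability) at negative arguments play no role.\<close>

definition claim_expect :: "real measure \<Rightarrow> (real \<Rightarrow> real) \<Rightarrow> real" where
  "claim_expect \<nu> g = (LINT y:{0..}|\<nu>. g y)"

text \<open>Loaded premium \<open>(1 + \<theta>) lam E[Y - R] + (\<eta>/2) lam E[(Y - R)\<^sup>2]\<close> for the ceded risk, under the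
  mean-variance premium principle, is deducted from the income rate \<open>c\<close>.\<close>

definition net_premium ::
  "real measure \<Rightarrow> real \<Rightarrow> real \<Rightarrow> real \<Rightarrow> real \<Rightarrow> (real \<Rightarrow> real) \<Rightarrow> real" where
  "net_premium \<nu> lam \<theta> \<eta> c R =
     c - (1 + \<theta>) * lam * claim_expect \<nu> (\<lambda>y. y - R y)
       - \<eta> / 2 * lam * claim_expect \<nu> (\<lambda>y. (y - R y)\<^sup>2)"

definition admissible_retention ::
  "real measure \<Rightarrow> real \<Rightarrow> real \<Rightarrow> real \<Rightarrow> real \<Rightarrow> (real \<Rightarrow> real) \<Rightarrow> bool" where
  "admissible_retention \<nu> lam \<theta> \<eta> c R \<longleftrightarrow>
     R \<in> borel_measurable (restrict_space borel {0..}) \<and>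
     (\<forall>y\<ge>0. 0 \<le> R y \<and> R y \<le> y) \<and>
     net_premium \<nu> lam \<theta> \<eta> c R > lam * claim_expect \<nu> R"

definition kappa :: "real measure \<Rightarrow> real \<Rightarrow> real \<Rightarrow> real \<Rightarrow> real \<Rightarrow> real" where
  "kappa \<nu> lam \<theta> \<eta> c =
     (1 + \<theta>) * lam * claim_expect \<nu> (\<lambda>y. y) + \<eta> / 2 * lam * claim_expect \<nu> (\<lambda>y. y\<^sup>2) - c"

locale insurance_market = real_distribution \<nu>
  for \<nu> :: "real measure" +
  fixes \<alpha> lam \<theta> \<eta> c :: real
  assumes claim_pos: "cdf \<nu> 0 = 0"
    and claim_mgf: "\<exists>\<delta>>0. \<forall>t. \<bar>t\<bar> < \<delta> \<longrightarrow> integrable \<nu> (\<lambda>y. exp (t * y))"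
    and alpha: "0 \<le> \<alpha>" "\<alpha> < 1"
    and lambda_pos: "lam > 0"
    and theta_nonneg: "\<theta> \<ge> 0"
    and eta_nonneg: "\<eta> \<ge> 0"
    and income_lower: "lam * claim_expect \<nu> (\<lambda>y. y) < c"
    and income_upper:
      "c < (1 + \<theta>) * lam * claim_expect \<nu> (\<lambda>y. y) + \<eta> / 2 * lam * claim_expect \<nu> (\<lambda>y. y\<^sup>2)"

subsection \<open>The claim process\<close>

text \<open>\<open>N\<close> is a Poisson process of rate \<open>lam\<close> relative to the filtration and \<open>Z n\<close> is the size of the
  claim that arrives at the \<open>n\<close>-th jump of \<open>N\<close> (counted from 0).  \<open>F\<close> has index type \<^typ>\<open>real\<close>,
  but only \<open>F t\<close> with \<open>t \<ge> 0\<close> carries meaning.\<close>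

definition aggregate_claims :: "(real \<Rightarrow> 'a \<Rightarrow> nat) \<Rightarrow> (nat \<Rightarrow> 'a \<Rightarrow> real) \<Rightarrow> real \<Rightarrow> 'a \<Rightarrow> real" where
  "aggregate_claims N Z t \<omega> = (\<Sum>n<N t \<omega>. Z n \<omega>)"

definition jump_time :: "(real \<Rightarrow> 'a \<Rightarrow> nat) \<Rightarrow> nat \<Rightarrow> 'a \<Rightarrow> real" where
  "jump_time N n \<omega> = Inf {t. 0 \<le> t \<and> n < N t \<omega>}"

locale drawdown_model =
  P: prob_space P + filtration "space P" F + market: insurance_market \<nu> \<alpha> lam \<theta> \<eta> c
  for P :: "'a measure" and F :: "real \<Rightarrow> 'a measure"
    and N :: "real \<Rightarrow> 'a \<Rightarrow> nat" and Z :: "nat \<Rightarrow> 'a \<Rightarrow> real"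
    and \<nu> :: "real measure" and \<alpha> lam \<theta> \<eta> c :: real +
  assumes filtration_sub: "\<And>t. sets (F t) \<subseteq> sets P"
    and counting_paths:
      "AE \<omega> in P. N 0 \<omega> = 0 \<and> mono_on {0..} (\<lambda>t. N t \<omega>) \<and>
         (\<forall>t\<ge>0. continuous (at_right t) (\<lambda>s. N s \<omega>))"
    and claims_adapted:
      "\<And>t. 0 \<le> t \<Longrightarrow> N t \<in> measurable (F t) (count_space UNIV)"
      "\<And>t. 0 \<le> t \<Longrightarrow> aggregate_claims N Z t \<in> borel_measurable (F t)"
    and poisson_increments:
      "\<And>s t. 0 \<le> s \<Longrightarrow> s < t \<Longrightarrow>
         distr P (count_space UNIV) (\<lambda>\<omega>. N t \<omega> - N s \<omega>) = measure_pmf (poisson_pmf (lam * (t - s)))"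
    and increments_indep_past:
      "\<And>s t. 0 \<le> s \<Longrightarrow> s < t \<Longrightarrow>
         P.indep_set (sets (F s))
           (sets (vimage_algebra (space P)
              (\<lambda>\<omega>. (N t \<omega> - N s \<omega>, aggregate_claims N Z t \<omega> - aggregate_claims N Z s \<omega>))
              (count_space UNIV \<Otimes>\<^sub>M borel)))"
    and claim_sizes_indep: "P.indep_vars (\<lambda>_. borel) Z UNIV"
    and claim_sizes_law: "\<And>n. distr P borel (Z n) = \<nu>"
    and claim_sizes_indep_arrivals:
      "P.indep_set
         (sets (vimage_algebra (space P) (\<lambda>\<omega>. \<lambda>t\<in>{0..}. N t \<omega>) (\<Pi>\<^sub>M t\<in>{0..}. count_space UNIV)))
         (sets (vimage_algebra (space P) (\<lambda>\<omega> n. Z n \<omega>) (\<Pi>\<^sub>M n\<in>UNIV. borel)))"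

subsection \<open>Retention strategies and the controlled surplus\<close>

text \<open>The \<open>\<sigma>\<close>-algebra of events strictly before \<open>t\<close>, with the usual convention at time 0.\<close>

definition strict_past :: "(real \<Rightarrow> 'a measure) \<Rightarrow> real \<Rightarrow> 'a measure" where
  "strict_past F t = (if t \<le> 0 then F 0 else sigma (space (F 0)) (\<Union>s\<in>{0..<t}. sets (F s)))"

text \<open>\<open>R t \<omega> y\<close> is the part of a claim of size \<open>y\<close> retained at time \<open>t\<close>.\<close>

definition admissible_strategy ::
  "'a measure \<Rightarrow> (real \<Rightarrow> 'a measure) \<Rightarrow> real measure \<Rightarrow> real \<Rightarrow> real \<Rightarrow> real \<Rightarrow> real
     \<Rightarrow> (real \<Rightarrow> 'a \<Rightarrow> real \<Rightarrow> real) \<Rightarrow> bool" where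
  "admissible_strategy P F \<nu> lam \<theta> \<eta> c R \<longleftrightarrow>
     (\<forall>t\<ge>0. (\<lambda>(\<omega>, y). R t \<omega> y)
        \<in> borel_measurable (strict_past F t \<Otimes>\<^sub>M restrict_space borel {0..})) \<and>
     (\<forall>t\<ge>0. (\<lambda>(s, \<omega>, y). R s \<omega> y)
        \<in> borel_measurable (restrict_space borel {0..t} \<Otimes>\<^sub>M F t \<Otimes>\<^sub>M restrict_space borel {0..})) \<and>
     (\<forall>t\<ge>0. \<forall>\<omega>\<in>space P. \<forall>y\<ge>0. 0 \<le> R t \<omega> y \<and> R t \<omega> y \<le> y) \<and>
     (AE \<omega> in P. \<forall>t\<ge>0. net_premium \<nu> lam \<theta> \<eta> c (R t \<omega>) > lam * claim_expect \<nu> (R t \<omega>))"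

text \<open>Strategies do not refer to the surplus itself, so the equation for the surplus
  integrates explicitly, path by path.\<close>

definition surplus ::
  "(real \<Rightarrow> 'a \<Rightarrow> nat) \<Rightarrow> (nat \<Rightarrow> 'a \<Rightarrow> real) \<Rightarrow> real measure \<Rightarrow> real \<Rightarrow> real \<Rightarrow> real \<Rightarrow> real
     \<Rightarrow> (real \<Rightarrow> 'a \<Rightarrow> real \<Rightarrow> real) \<Rightarrow> real \<Rightarrow> real \<Rightarrow> 'a \<Rightarrow> real" where
  "surplus N Z \<nu> lam \<theta> \<eta> c R x t \<omega> =
     x + (LINT s:{0..t}|lborel. net_premium \<nu> lam \<theta> \<eta> c (R s \<omega>))
       - (\<Sum>n<N t \<omega>. R (jump_time N n \<omega>) \<omega> (Z n \<omega>))"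

definition running_max :: "(real \<Rightarrow> 'a \<Rightarrow> real) \<Rightarrow> real \<Rightarrow> real \<Rightarrow> 'a \<Rightarrow> real" where
  "running_max X m t \<omega> = max (SUP s\<in>{0..t}. X s \<omega>) m"

definition drawdown_time :: "real \<Rightarrow> (real \<Rightarrow> 'a \<Rightarrow> real) \<Rightarrow> real \<Rightarrow> 'a \<Rightarrow> ereal" where
  "drawdown_time \<alpha> X m \<omega> = Inf (ereal ` {t. 0 \<le> t \<and> X t \<omega> < \<alpha> * running_max X m t \<omega>})"

text \<open>The completion of \<open>P\<close> is used because neither \<open>P\<close> nor the filtration is assumed complete,
  while path properties hold only almost surely; without it, the drawdown event could fail to be
  measurable because of a null set, and its measure would then be 0 by convention.\<close>

definition drawdown_prob ::
  "'a measure \<Rightarrow> (real \<Rightarrow> 'a \<Rightarrow> nat) \<Rightarrow> (nat \<Rightarrow> 'a \<Rightarrow> real) \<Rightarrow> real measure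
     \<Rightarrow> real \<Rightarrow> real \<Rightarrow> real \<Rightarrow> real \<Rightarrow> real \<Rightarrow> (real \<Rightarrow> 'a \<Rightarrow> real \<Rightarrow> real) \<Rightarrow> real \<Rightarrow> real \<Rightarrow> real" where
  "drawdown_prob P N Z \<nu> \<alpha> lam \<theta> \<eta> c R x m =
     measure (completion P)
       {\<omega> \<in> space P. drawdown_time \<alpha> (surplus N Z \<nu> lam \<theta> \<eta> c R x) m \<omega> < \<infinity>}"

definition min_drawdown_prob ::
  "'a measure \<Rightarrow> (real \<Rightarrow> 'a measure) \<Rightarrow> (real \<Rightarrow> 'a \<Rightarrow> nat) \<Rightarrow> (nat \<Rightarrow> 'a \<Rightarrow> real) \<Rightarrow> real measure
     \<Rightarrow> real \<Rightarrow> real \<Rightarrow> real \<Rightarrow> real \<Rightarrow> real \<Rightarrow> real \<Rightarrow> real \<Rightarrow> real" where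
  "min_drawdown_prob P F N Z \<nu> \<alpha> lam \<theta> \<eta> c x m =
     (INF R\<in>{R. admissible_strategy P F \<nu> lam \<theta> \<eta> c R}. drawdown_prob P N Z \<nu> \<alpha> lam \<theta> \<eta> c R x m)"

subsection \<open>Smooth functions on the domain and the generator\<close>

definition drawdown_domain :: "real \<Rightarrow> (real \<times> real) set" where
  "drawdown_domain \<alpha> = {(x, m). 0 \<le> x \<and> 0 \<le> m \<and> \<alpha> * m \<le> x \<and> x \<le> m}"

text \<open>\<open>v\<close> is continuously differentiable on the domain with partial derivatives \<open>vx\<close> and \<open>vm\<close>.
  Derivatives are taken within the sections of the domain, hence are one-sided on its boundary.
  They are determined by \<open>v\<close>: where a section degenerates to the single point 0 (at the corner),
  the value of the partial derivative is fixed by continuity.  Continuity of \<open>v\<close> is automatic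
  away from the corner.\<close>

definition C11_on_domain ::
  "real \<Rightarrow> (real \<times> real \<Rightarrow> real) \<Rightarrow> (real \<times> real \<Rightarrow> real) \<Rightarrow> (real \<times> real \<Rightarrow> real) \<Rightarrow> bool" where
  "C11_on_domain \<alpha> v vx vm \<longleftrightarrow>
     continuous_on (drawdown_domain \<alpha>) v \<and>
     continuous_on (drawdown_domain \<alpha>) vx \<and>
     continuous_on (drawdown_domain \<alpha>) vm \<and>
     (\<forall>(x, m) \<in> drawdown_domain \<alpha>.
        ((\<lambda>\<xi>. v (\<xi>, m)) has_real_derivative vx (x, m))
          (at x within {\<xi>. (\<xi>, m) \<in> drawdown_domain \<alpha>}) \<and>
        ((\<lambda>\<mu>. v (x, \<mu>)) has_real_derivative vm (x, m))
          (at m within {\<mu>. (x, \<mu>) \<in> drawdown_domain \<alpha>}))"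

text \<open>\<open>v\<close> is expected to be extended by 1 below the domain, i.e. for \<open>x < \<alpha> * m\<close>.\<close>

definition generator ::
  "real measure \<Rightarrow> real \<Rightarrow> real \<Rightarrow> real \<Rightarrow> real \<Rightarrow> (real \<Rightarrow> real)
     \<Rightarrow> (real \<times> real \<Rightarrow> real) \<Rightarrow> (real \<times> real \<Rightarrow> real) \<Rightarrow> real \<Rightarrow> real \<Rightarrow> real" where
  "generator \<nu> lam \<theta> \<eta> c R v vx x m =
     - kappa \<nu> lam \<theta> \<eta> c * vx (x, m) +
     lam * (((1 + \<theta>) * claim_expect \<nu> R + \<eta> * claim_expect \<nu> (\<lambda>y. y * R y)
             - \<eta> / 2 * claim_expect \<nu> (\<lambda>y. (R y)\<^sup>2)) * vx (x, m)
          + claim_expect \<nu> (\<lambda>y. v (x - R y, m)) - v (x, m))"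

end

(*
  Retain every claim according to the static strategy R of condition (iv).  Between claims the pair
  (X, M) moves deterministically upwards, so at claim times it is a Markov chain driven by the
  i.i.d. pairs (exponential interarrival time, claim size).  Multiplying the generator inequality
  by exp (-lam s) and integrating along the deterministic flow gives E v(X, M) <= v(x, m) for one
  step of the chain, and this survives stopping at the first time that the surplus reaches a level
  k, where (X, M) = (k, k).  From any state the chain reaches k before the next claim with
  probability at least exp (-lam k / p), p being the income rate, so the number of steps can be
  sent to infinity: the probability of drawdown before level k is at most v(x, m) + max 0 (- v(k, k)).
  Let k tend to infinity.

  The law of the interarrival times is obtained from the Poisson increments by approximating the
  arrival times with dyadic stopping times from above.
*)
theory Submission
  imports Defs
begin

subsection \<open>Smooth functions on the domain\<close>

text \<open>An infimum is bounded above by any single strategy, so no optimisation enters and a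
  bound for one static surplus is enough. The obstacle is that v may be negative: the inequality E
  v(X, M) <= v(x, m) bounds a probability only if the paths that have not drawn down are charged a
  controlled amount. Condition (i) controls v only far out on the diagonal, hence paths are stopped
  on reaching a level, where the state is a diagonal point, and not at a fixed time. The level also
  confines the flow to a compact time interval, on which the continuous v_x, not assumed bounded, is
  integrable. Paths that are still undecided after n claims are charged the bound of |v|, times a
  probability that decays geometrically in n.

  Condition (iii) acts while the flow runs along the diagonal. There v is differentiable only from
  inside the domain, so the derivative along the diagonal has to be assembled from mean values taken
  in the domain. On the probabilistic side the model speaks of increments over deterministic times
  only, so the Markov property at a random arrival time must come from events decided at fixed grid
  times.\<close>

lemma drawdown_domain_ascend:
  assumes \<alpha>: "0 \<le> \<alpha>" "\<alpha> < 1" and xm: "(x, m) \<in> drawdown_domain \<alpha>" and d: "0 \<le> d"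
  shows "(x + d, max m (x + d)) \<in> drawdown_domain \<alpha>"
proof -
  have "\<alpha> * max m (x + d) \<le> x + d"
  proof (cases "m \<le> x + d")
    case True
    then show ?thesis using \<alpha> xm d mult_right_mono[of \<alpha> 1 "x + d"]
      by (auto simp: drawdown_domain_def max_def)
  next
    case False
    then show ?thesis using xm d by (auto simp: drawdown_domain_def max_def)
  qed
  then show ?thesis using xm d by (auto simp: drawdown_domain_def)
qed

lemma C11_mvt_fst:
  assumes "C11_on_domain \<alpha> v vx vm" "a \<le> b" "(a, m) \<in> drawdown_domain \<alpha>" "(b, m) \<in> drawdown_domain \<alpha>"
  shows "\<exists>\<xi>. a \<le> \<xi> \<and> \<xi> \<le> b \<and> v (b, m) - v (a, m) = vx (\<xi>, m) * (b - a)"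
proof (cases "a = b")
  case False
  have "((\<lambda>\<xi>. v (\<xi>, m)) has_derivative (*) (vx (\<xi>, m))) (at \<xi> within {a..b})" if "a \<le> \<xi>" "\<xi> \<le> b" for \<xi>
  proof -
    have "(\<xi>, m) \<in> drawdown_domain \<alpha>" using assms that by (auto simp: drawdown_domain_def)
    then have "((\<lambda>\<xi>. v (\<xi>, m)) has_real_derivative vx (\<xi>, m)) (at \<xi> within {\<xi>. (\<xi>, m) \<in> drawdown_domain \<alpha>})"
      using assms(1) by (auto simp: C11_on_domain_def)
    then show ?thesis
      unfolding has_field_derivative_def
      by (rule has_derivative_subset) (use assms in \<open>auto simp: drawdown_domain_def\<close>)
  qed
  then have "\<exists>\<xi>\<in>{a<..<b}. v (b, m) - v (a, m) = vx (\<xi>, m) * (b - a)"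
    using False assms(2) by (intro mvt_simple) auto
  then show ?thesis by (metis greaterThanLessThan_iff less_imp_le)
qed auto

lemma C11_mvt_snd:
  assumes "C11_on_domain \<alpha> v vx vm" "0 \<le> \<alpha>" "a \<le> b" "(x, a) \<in> drawdown_domain \<alpha>" "(x, b) \<in> drawdown_domain \<alpha>"
  shows "\<exists>\<mu>. a \<le> \<mu> \<and> \<mu> \<le> b \<and> v (x, b) - v (x, a) = vm (x, \<mu>) * (b - a)"
proof (cases "a = b")
  case False
  have sec: "(x, \<mu>) \<in> drawdown_domain \<alpha>" if "a \<le> \<mu>" "\<mu> \<le> b" for \<mu>
    using assms that mult_left_mono[of \<mu> b \<alpha>] by (auto simp: drawdown_domain_def)
  have "((\<lambda>\<mu>. v (x, \<mu>)) has_derivative (*) (vm (x, \<mu>))) (at \<mu> within {a..b})" if "a \<le> \<mu>" "\<mu> \<le> b" for \<mu>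
  proof -
    have "((\<lambda>\<mu>. v (x, \<mu>)) has_real_derivative vm (x, \<mu>)) (at \<mu> within {\<mu>. (x, \<mu>) \<in> drawdown_domain \<alpha>})"
      using assms(1) sec[OF that] by (auto simp: C11_on_domain_def)
    then show ?thesis
      unfolding has_field_derivative_def
      by (rule has_derivative_subset) (use sec in auto)
  qed
  then have "\<exists>\<mu>\<in>{a<..<b}. v (x, b) - v (x, a) = vm (x, \<mu>) * (b - a)"
    using False assms(3) by (intro mvt_simple) auto
  then show ?thesis by (metis greaterThanLessThan_iff less_imp_le)
qed auto

text \<open>The domain contains no neighbourhood of a diagonal point, so the chain rule for two
  variables is out of reach. For a <= b the corner (a, b) lies in the domain while (b, a) need not;
  the increment from (a, a) to (b, b) is therefore split at (a, b), and the mean value theorem is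
  applied in each coordinate.\<close>

lemma C11_diagonal_derivative:
  assumes C: "C11_on_domain \<alpha> v vx vm" and \<alpha>: "0 \<le> \<alpha>" "\<alpha> < 1" and y: "0 < y"
  shows "((\<lambda>y. v (y, y)) has_real_derivative vx (y, y) + vm (y, y)) (at y)"
proof -
  let ?D = "drawdown_domain \<alpha>"
  have yD: "(y, y) \<in> ?D" using y \<alpha> mult_right_mono[of \<alpha> 1 y] by (auto simp: drawdown_domain_def)
  have "\<exists>d>0. \<forall>z. norm (z - y) < d \<longrightarrow>
     norm (v (z, z) - v (y, y) - (vx (y, y) + vm (y, y)) * (z - y)) \<le> e * norm (z - y)" if e: "0 < e" for e
  proof -
    have cont: "\<exists>d>0. \<forall>z\<in>?D. dist z (y, y) < d \<longrightarrow> dist (f z) (f (y, y)) < e / 2"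
      if "continuous_on ?D f" for f :: "real \<times> real \<Rightarrow> real"
      using that yD e unfolding continuous_on_iff by (meson half_gt_zero)
    obtain d1 where d1: "d1 > 0" "\<And>z. z\<in>?D \<Longrightarrow> dist z (y, y) < d1 \<Longrightarrow> dist (vx z) (vx (y, y)) < e / 2"
      using cont[of vx] C by (auto simp: C11_on_domain_def)
    obtain d2 where d2: "d2 > 0" "\<And>z. z\<in>?D \<Longrightarrow> dist z (y, y) < d2 \<Longrightarrow> dist (vm z) (vm (y, y)) < e / 2"
      using cont[of vm] C by (auto simp: C11_on_domain_def)
    \<comment> \<open>Halving \<open>d1\<close> and \<open>d2\<close> absorbs the factor 2 in
      \<open>close\<close>. The bound y * (1 - \<alpha>) / 2 gives \<alpha> * (y + d) <= y - d, and
      d <= y keeps the coordinates nonnegative; together they yield \<open>inD\<close>.\<close>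
    define d where "d = min (min d1 d2 / 2) (min (y * (1 - \<alpha>) / 2) y)"
    have d: "d > 0" "d \<le> d1 / 2" "d \<le> d2 / 2" "d \<le> y * (1 - \<alpha>) / 2" "d \<le> y"
      using d1(1) d2(1) y \<alpha> unfolding d_def by (simp, linarith+)
    have inD: "(a, b) \<in> ?D" if "\<bar>a - y\<bar> < d" "\<bar>b - y\<bar> < d" "a \<le> b" for a b
    proof -
      have "\<alpha> * b \<le> \<alpha> * (y + d)" using that \<alpha> by (intro mult_left_mono) auto
      also have "\<dots> \<le> \<alpha> * y + d" using d \<alpha> mult_right_mono[of \<alpha> 1 d] by (simp add: algebra_simps)
      also have "\<dots> \<le> y - d" using d(4) by (simp add: field_simps)
      finally show ?thesis using that d by (auto simp: drawdown_domain_def)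
    qed
    have close: "dist (a, b) (y, y) < 2 * d" if "\<bar>a - y\<bar> < d" "\<bar>b - y\<bar> < d" for a b
      using that real_sqrt_sum_squares_triangle_ineq[of "a - y" 0 0 "b - y"]
      by (simp add: dist_Pair_Pair dist_real_def)
    have incr: "\<bar>v (b, b) - v (a, a) - (vx (y, y) + vm (y, y)) * (b - a)\<bar> \<le> e * (b - a)"
      if ab: "\<bar>a - y\<bar> < d" "\<bar>b - y\<bar> < d" "a \<le> b" for a b
    proof -
      obtain \<xi> where \<xi>: "a \<le> \<xi>" "\<xi> \<le> b" "v (b, b) - v (a, b) = vx (\<xi>, b) * (b - a)"
        using C11_mvt_fst[OF C, of a b b] inD[of a b] inD[of b b] ab by auto
      obtain \<mu> where \<mu>: "a \<le> \<mu>" "\<mu> \<le> b" "v (a, b) - v (a, a) = vm (a, \<mu>) * (b - a)"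
        using C11_mvt_snd[OF C \<alpha>(1), of a b a] inD[of a b] inD[of a a] ab by auto
      have "dist (vx (\<xi>, b)) (vx (y, y)) < e / 2"
        by (rule d1(2)[OF inD less_le_trans[OF close]]) (use \<xi> ab d in auto)
      moreover have "dist (vm (a, \<mu>)) (vm (y, y)) < e / 2"
        by (rule d2(2)[OF inD less_le_trans[OF close]]) (use \<mu> ab d in auto)
      ultimately have "\<bar>(vx (\<xi>, b) - vx (y, y)) + (vm (a, \<mu>) - vm (y, y))\<bar> \<le> e"
        unfolding dist_real_def by linarith
      then have "\<bar>((vx (\<xi>, b) - vx (y, y)) + (vm (a, \<mu>) - vm (y, y))) * (b - a)\<bar> \<le> e * (b - a)"
        using ab by (simp add: abs_mult mult_right_mono)
      moreover have "v (b, b) - v (a, a) - (vx (y, y) + vm (y, y)) * (b - a)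
          = ((vx (\<xi>, b) - vx (y, y)) + (vm (a, \<mu>) - vm (y, y))) * (b - a)"
        using \<xi>(3) \<mu>(3) by (simp add: algebra_simps)
      ultimately show ?thesis by simp
    qed
    show ?thesis
    proof (intro exI[of _ d] conjI allI impI d(1))
      fix z assume "norm (z - y) < d"
      then show "norm (v (z, z) - v (y, y) - (vx (y, y) + vm (y, y)) * (z - y)) \<le> e * norm (z - y)"
        using incr[of y z] incr[of z y] d(1)
        by (cases "y \<le> z") (auto simp: abs_if algebra_simps split: if_splits)
    qed
  qed
  then show ?thesis
    unfolding has_field_derivative_def has_derivative_at_alt by (auto intro: bounded_linear_mult_right)
qed

text \<open>Between two claims the pair of surplus and running maximum moves along
  \<open>s \<mapsto> (x + p * s, max m (x + p * s))\<close>; \<open>t\<close> is the time at which it meets \<open>(k, k)\<close>.\<close>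

lemma first_claim_inequality:
  assumes C: "C11_on_domain \<alpha> v vx vm" and \<alpha>: "0 \<le> \<alpha>" "\<alpha> < 1" and p: "p > 0" and l: "l > 0"
    and vm: "\<And>y. 0 \<le> y \<Longrightarrow> vm (y, y) \<le> 0"
    and xm: "(x, m) \<in> drawdown_domain \<alpha>" "x < k" "m \<le> k" and t: "t = (k - x) / p"
    and G: "\<And>s. 0 \<le> s \<Longrightarrow> s \<le> t \<Longrightarrow>
        p * vx (x + p * s, max m (x + p * s)) + l * (G s - v (x + p * s, max m (x + p * s))) \<le> 0"
    and int: "set_integrable lborel {0..t} (\<lambda>s. l * exp (- l * s) * G s)"
  shows "(LINT s:{0..t}|lborel. l * exp (- l * s) * G s) \<le> v (x, m) - exp (- l * t) * v (k, k)"
proof -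
  let ?D = "drawdown_domain \<alpha>"
  define z where "z s = (x + p * s, max m (x + p * s))" for s
  have t0: "t > 0" using t p xm by simp
  have pt: "x + p * t = k" using t p by simp
  have le_k: "x + p * s \<le> k" if "s \<le> t" for s using mult_left_mono[OF that, of p] p pt by linarith
  have zD: "z s \<in> ?D" if "0 \<le> s" for s
    unfolding z_def using p that by (intro drawdown_domain_ascend[OF \<alpha> xm(1)]) simp
  have contz: "continuous_on {0..t} (\<lambda>s. f (z s))" if "continuous_on ?D f" for f :: "real \<times> real \<Rightarrow> real"
    by (rule continuous_on_compose2[OF that]) (auto simp: z_def[abs_def] intro!: continuous_intros zD[unfolded z_def])
  have cv: "continuous_on {0..t} (\<lambda>s. v (z s))" and cvx: "continuous_on {0..t} (\<lambda>s. vx (z s))"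
    using C contz by (auto simp: C11_on_domain_def)
  \<comment> \<open>By hypothesis \<open>G\<close> lies below (l * v - p * vx) / l along the flow.
    \<open>G\<close> is merely integrable, so this continuous upper bound, weighted by the
    exponential, is integrated in its place; it makes \<open>H\<close> differentiable off the
    kink.\<close>
  define b where "b s = exp (- l * s) * (l * v (z s) - p * vx (z s))" for s
  have cb: "continuous_on {0..t} b"
    unfolding b_def using cv cvx by (intro continuous_intros)
  define H where "H s = exp (- l * s) * v (z s) + integral {0..s} b" for s
  have contH: "continuous_on {0..t} H"
    unfolding H_def using cv cb by (intro continuous_intros indefinite_integral_continuous_1 integrable_continuous_real)
  have derivH: "\<exists>y. DERIV H s :> y \<and> y \<le> 0" if s: "0 < s" "s < t" "x + p * s \<noteq> m" for s
  proof -
    have "\<exists>g'. DERIV (\<lambda>s. v (z s)) s :> g' \<and> g' \<le> p * vx (z s)"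
    proof (cases "x + p * s < m")
      case True
      have lo: "\<alpha> * m < x + p * s" using xm mult_pos_pos[OF p s(1)] unfolding drawdown_domain_def by simp
      have xs: "0 < x + p * s" using xm p s by (auto simp: drawdown_domain_def add_nonneg_pos)
      have "((\<lambda>\<xi>. v (\<xi>, m)) has_real_derivative vx (x + p * s, m))
          (at (x + p * s) within {\<xi>. (\<xi>, m) \<in> ?D})"
        using C True lo xs xm by (auto simp: C11_on_domain_def drawdown_domain_def)
      then have "((\<lambda>\<xi>. v (\<xi>, m)) has_real_derivative vx (x + p * s, m))
          (at (x + p * s) within {max 0 (\<alpha> * m)<..<m})"
        by (rule DERIV_subset) (use xm in \<open>auto simp: drawdown_domain_def\<close>)
      then have "((\<lambda>\<xi>. v (\<xi>, m)) has_real_derivative vx (x + p * s, m)) (at (x + p * s))"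
        using True lo xs by (subst (asm) at_within_open) auto
      then have "DERIV (\<lambda>s. v (x + p * s, m)) s :> vx (x + p * s, m) * p"
        by (rule DERIV_chain2[where f="\<lambda>\<xi>. v (\<xi>, m)" and g="\<lambda>s. x + p * s"]) (auto intro!: derivative_eq_intros)
      moreover have "\<forall>\<^sub>F s' in nhds s. v (z s') = v (x + p * s', m)"
      proof -
        have "open {s'. x + p * s' < m}" by (intro open_Collect_less continuous_intros)
        then have "\<forall>\<^sub>F s' in nhds s. x + p * s' < m"
          using True eventually_nhds_in_open[of "{s'. x + p * s' < m}" s] by simp
        then show ?thesis by eventually_elim (simp add: z_def max_def)
      qed
      ultimately have "DERIV (\<lambda>s. v (z s)) s :> vx (x + p * s, m) * p"
        by (subst DERIV_cong_ev) auto
      then show ?thesis using True by (auto simp: z_def max_def mult.commute)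
    next
      case False
      have xs: "0 < x + p * s" using xm p s by (auto simp: drawdown_domain_def add_nonneg_pos)
      from C11_diagonal_derivative[OF C \<alpha> xs]
      have "DERIV (\<lambda>s. v (x + p * s, x + p * s)) s :> (vx (x + p * s, x + p * s) + vm (x + p * s, x + p * s)) * p"
        by (rule DERIV_chain2[where f="\<lambda>\<xi>. v (\<xi>, \<xi>)" and g="\<lambda>s. x + p * s"]) (auto intro!: derivative_eq_intros)
      moreover have "\<forall>\<^sub>F s' in nhds s. v (z s') = v (x + p * s', x + p * s')"
      proof -
        have "open {s'. m < x + p * s'}" by (intro open_Collect_less continuous_intros)
        then have "\<forall>\<^sub>F s' in nhds s. m < x + p * s'"
          using False s eventually_nhds_in_open[of "{s'. m < x + p * s'}" s] by simp
        then show ?thesis by eventually_elim (simp add: z_def max_def)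
      qed
      ultimately have "DERIV (\<lambda>s. v (z s)) s :> (vx (x + p * s, x + p * s) + vm (x + p * s, x + p * s)) * p"
        by (subst DERIV_cong_ev) auto
      \<comment> \<open>On the diagonal the running maximum rises together with the surplus and
        contributes p * vm, which the sign of \<open>vm\<close> there allows to be dropped.\<close>
      moreover have "(vx (x + p * s, x + p * s) + vm (x + p * s, x + p * s)) * p \<le> p * vx (z s)"
        using False vm[of "x + p * s"] p xs by (simp add: z_def max_def algebra_simps mult_nonneg_nonpos)
      ultimately show ?thesis by blast
    qed
    then obtain g' where g': "DERIV (\<lambda>s. v (z s)) s :> g'" "g' \<le> p * vx (z s)" by blast
    have "((\<lambda>u. integral {0..u} b) has_real_derivative b s) (at s within {0..t})"
      using s by (intro integral_has_real_derivative cb) auto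
    then have "((\<lambda>u. integral {0..u} b) has_real_derivative b s) (at s)"
      using s by (subst (asm) at_within_interior) (auto simp: interior_atLeastAtMost_real)
    from DERIV_add[OF DERIV_mult[OF _ g'(1)] this]
    have "DERIV H s :> - l * exp (- l * s) * v (z s) + g' * exp (- l * s) + b s"
      unfolding H_def by (rule DERIV_cong) (auto intro!: derivative_eq_intros)
    moreover have "- l * exp (- l * s) * v (z s) + g' * exp (- l * s) + b s = exp (- l * s) * (g' - p * vx (z s))"
      by (simp add: b_def algebra_simps)
    ultimately show ?thesis using g'(2) by (intro exI conjI) (auto simp: mult_nonneg_nonpos)
  qed
  have mono: "H c \<ge> H d" if "0 \<le> c" "c \<le> d" "d \<le> t" "\<And>s. c < s \<Longrightarrow> s < d \<Longrightarrow> x + p * s \<noteq> m" for c d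
    by (rule DERIV_nonpos_imp_decreasing_open)
       (use that in \<open>auto intro!: derivH continuous_on_subset[OF contH]\<close>)
  \<comment> \<open>At \<open>s0\<close> the running maximum starts to move and the flow has a kink.
    Monotonicity is obtained on either side and joined by continuity of \<open>H\<close>.\<close>
  have "H t \<le> H 0"
  proof -
    define s0 where "s0 = (m - x) / p"
    have s0: "x + p * s = m \<longleftrightarrow> s = s0" for s using p by (auto simp: s0_def field_simps)
    have "0 \<le> s0" "s0 \<le> t" using p xm t by (auto simp: s0_def drawdown_domain_def divide_right_mono)
    then have "H s0 \<le> H 0" "H t \<le> H s0" using mono[of 0 s0] mono[of s0 t] s0 by auto
    then show ?thesis by simp
  qed
  moreover have "z 0 = (x, m)" "z t = (k, k)" using xm pt by (auto simp: z_def drawdown_domain_def)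
  ultimately have Hb: "integral {0..t} b \<le> v (x, m) - exp (- l * t) * v (k, k)"
    by (simp add: H_def)
  have bint: "set_integrable lborel {0..t} b"
    using borel_integrable_compact[of "{0..t}" b] cb by (simp add: set_integrable_def indicator_def if_distrib cong: if_cong)
  have "(LINT s:{0..t}|lborel. l * exp (- l * s) * G s) \<le> (LINT s:{0..t}|lborel. b s)"
  proof (rule set_integral_mono[OF int bint])
    fix s assume "s \<in> {0..t}"
    with G[of s] have "l * G s \<le> l * v (z s) - p * vx (z s)" by (simp add: z_def algebra_simps)
    then have "exp (- l * s) * (l * G s) \<le> b s" unfolding b_def by (intro mult_left_mono) auto
    then show "l * exp (- l * s) * G s \<le> b s" by (simp add: mult_ac)
  qed
  also have "\<dots> = integral {0..t} b" using set_borel_integral_eq_integral[OF bint] by simp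
  finally show ?thesis using Hb by simp
qed

subsection \<open>Arrival times of a counting path\<close>

text \<open>The arrival time of the \<open>i\<close>-th claim (counted from 1) is read off the dyadic grids.  Unlike
  \<^const>\<open>jump_time\<close>, this makes it measurable for the \<open>\<sigma>\<close>-algebra generated by the
  counting variables, without any regularity of the paths.\<close>

definition grid_index :: "(real \<Rightarrow> nat) \<Rightarrow> nat \<Rightarrow> nat \<Rightarrow> nat" where
  "grid_index f i k = (LEAST j. i \<le> f (real j / 2 ^ k))"

definition arrival :: "(real \<Rightarrow> nat) \<Rightarrow> nat \<Rightarrow> real" where
  "arrival f i = lim (\<lambda>k. real (grid_index f i k) / 2 ^ k)"

definition arrival_gap :: "(real \<Rightarrow> nat) \<Rightarrow> nat \<Rightarrow> real" where
  "arrival_gap f i = arrival f (Suc i) - arrival f i"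

text \<open>The last clause makes every arrival time finite. It is not among the assumptions on the
  paths of \<open>N\<close>, but follows almost surely from the Poisson law.\<close>

definition counting_path :: "(real \<Rightarrow> nat) \<Rightarrow> bool" where
  "counting_path f \<longleftrightarrow> f 0 = 0 \<and> mono_on {0..} f \<and> (\<forall>t\<ge>0. continuous (at_right t) f) \<and> (\<forall>i. \<exists>t\<ge>0. i \<le> f t)"

text \<open>Under the stated equivalence the index belongs to the first grid point at or after
  \<open>T\<close>, so the overshoot is below the mesh width.\<close>

lemma grid_bounds:
  assumes "0 \<le> T" "\<And>t. 0 \<le> t \<Longrightarrow> i \<le> f t \<longleftrightarrow> T \<le> t"
  shows "T \<le> real (grid_index f i k) / 2 ^ k" "real (grid_index f i k) / 2 ^ k < T + 1 / 2 ^ k"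
proof -
  have *: "grid_index f i k = (LEAST j. T \<le> real j / 2 ^ k)"
    unfolding grid_index_def using assms by simp
  obtain j0 where "T * 2 ^ k \<le> real j0" using real_arch_simple by blast
  then have j0: "T \<le> real j0 / 2 ^ k" by (simp add: field_simps)
  show "T \<le> real (grid_index f i k) / 2 ^ k" unfolding * by (rule LeastI[of _ j0]) (rule j0)
  show "real (grid_index f i k) / 2 ^ k < T + 1 / 2 ^ k"
  proof (cases "grid_index f i k")
    case 0
    then show ?thesis using assms(1) by (simp add: add_nonneg_pos)
  next
    case (Suc j)
    then have "\<not> T \<le> real j / 2 ^ k" using not_less_Least[of j "\<lambda>j. T \<le> real j / 2 ^ k"] * by simp
    then show ?thesis using Suc by (simp add: add_divide_distrib)
  qed
qed

lemma grid_tendsto: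
  assumes "0 \<le> T" "\<And>t. 0 \<le> t \<Longrightarrow> i \<le> f t \<longleftrightarrow> T \<le> t"
  shows "(\<lambda>k. real (grid_index f i k) / 2 ^ k) \<longlonglongrightarrow> T"
proof (rule tendsto_sandwich[where f="\<lambda>_. T" and h="\<lambda>k. T + 1 / 2 ^ k"])
  have "(\<lambda>k. (1 / 2 :: real) ^ k) \<longlonglongrightarrow> 0" by (rule LIMSEQ_power_zero) simp
  from tendsto_add[OF tendsto_const[of T] this]
  show "(\<lambda>k. T + 1 / 2 ^ k) \<longlonglongrightarrow> T" by (simp add: power_one_over)
  show "\<forall>\<^sub>F k in sequentially. T \<le> real (grid_index f i k) / 2 ^ k"
    "\<forall>\<^sub>F k in sequentially. real (grid_index f i k) / 2 ^ k \<le> T + 1 / 2 ^ k"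
    using grid_bounds[of T i f, OF assms] by (auto intro!: always_eventually less_imp_le)
qed simp

text \<open>The infimum of the times with count at least \<open>i\<close> is attained: values are
  discrete, so right continuity makes \<open>f\<close> constant just after the infimum, and points
  of the set lie arbitrarily close to it. All later facts about arrivals go through the resulting
  equivalence.\<close>

lemma counting_path_arrival:
  assumes f: "counting_path f"
  shows "0 \<le> arrival f i" and "0 \<le> t \<Longrightarrow> i \<le> f t \<longleftrightarrow> arrival f i \<le> t"
proof -
  define S where "S = {t. 0 \<le> t \<and> i \<le> f t}"
  define T where "T = Inf S"
  have ne: "S \<noteq> {}" and bdd: "bdd_below S"
    using f by (auto simp: counting_path_def S_def intro!: bdd_belowI[of _ 0])
  have T0: "0 \<le> T" unfolding T_def by (rule cInf_greatest[OF ne]) (auto simp: S_def)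
  have "\<forall>\<^sub>F s in at_right T. f s = f T"
    using f T0 by (auto simp: counting_path_def continuous_within tendsto_discrete)
  then obtain b where b: "T < b" "\<And>s. T < s \<Longrightarrow> s < b \<Longrightarrow> f s = f T"
    by (auto simp: eventually_at_right[of T "T + 1"])
  obtain s where s: "s \<in> S" "s < b" using b(1) cInf_less_iff[OF ne bdd] by (auto simp: T_def)
  have "T \<le> s" unfolding T_def by (rule cInf_lower[OF s(1) bdd])
  then have iT: "i \<le> f T" using b(2)[of s] s by (cases "s = T") (auto simp: S_def)
  have iff: "i \<le> f t \<longleftrightarrow> T \<le> t" if t: "0 \<le> t" for t
  proof
    assume "i \<le> f t" then show "T \<le> t" unfolding T_def using t by (intro cInf_lower bdd) (auto simp: S_def)
  next
    assume "T \<le> t" then have "f T \<le> f t" using f T0 t by (auto simp: counting_path_def mono_on_def)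
    then show "i \<le> f t" using iT by simp
  qed
  have "arrival f i = T" unfolding arrival_def by (intro limI grid_tendsto T0 iff)
  then show "0 \<le> arrival f i" "0 \<le> t \<Longrightarrow> i \<le> f t \<longleftrightarrow> arrival f i \<le> t" using T0 iff by auto
qed

lemma counting_path_grid:
  assumes f: "counting_path f"
  shows "arrival f i \<le> real (grid_index f i k) / 2 ^ k"
    and "real (grid_index f i k) / 2 ^ k < arrival f i + 1 / 2 ^ k"
    and "(\<lambda>k. real (grid_index f i k) / 2 ^ k) \<longlonglongrightarrow> arrival f i"
  using grid_bounds[OF counting_path_arrival(1)[OF f] counting_path_arrival(2)[OF f]]
    grid_tendsto[OF counting_path_arrival(1)[OF f] counting_path_arrival(2)[OF f]] by auto

lemma counting_path_arrival_0: "counting_path f \<Longrightarrow> arrival f 0 = 0"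
  using counting_path_arrival(1)[of f 0] counting_path_arrival(2)[of f 0 0] by simp

lemma counting_path_arrival_mono:
  assumes f: "counting_path f" and "i \<le> j"
  shows "arrival f i \<le> arrival f j"
  using counting_path_arrival[OF f, of j] counting_path_arrival(2)[OF f, of "arrival f j" i]
    counting_path_arrival(2)[OF f, of "arrival f j" j] assms(2) by simp

text \<open>An arrival that has occurred by time \<open>t\<close> is determined by the path up to
  \<open>t\<close>. This is what makes events about earlier gaps measurable with respect to the
  filtration at a grid time.\<close>

lemma arrival_stopped:
  assumes f: "counting_path f" and t: "0 \<le> t" "i \<le> f t"
  shows "arrival (\<lambda>s. f (min s t)) i = arrival f i"
proof -
  have "i \<le> f (min s t) \<longleftrightarrow> i \<le> f s" if "0 \<le> s" for s
    using t that counting_path_arrival(2)[OF f, of s i] counting_path_arrival(2)[OF f, of t i]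
    by (cases "s \<le> t") auto
  then have "grid_index (\<lambda>s. f (min s t)) i k = grid_index f i k" for k
    unfolding grid_index_def by simp
  then show ?thesis unfolding arrival_def by simp
qed

section \<open>Measurability of the arrival times\<close>

lemma measurable_grid_index:
  assumes [measurable]: "\<And>t. 0 \<le> t \<Longrightarrow> N t \<in> measurable M (count_space UNIV)"
  shows "(\<lambda>\<omega>. grid_index (\<lambda>t. N t \<omega>) i k) \<in> measurable M (count_space UNIV)"
  unfolding grid_index_def by measurable

lemma borel_measurable_arrival_gap:
  assumes "\<And>t. 0 \<le> t \<Longrightarrow> N t \<in> measurable M (count_space UNIV)"
  shows "(\<lambda>\<omega>. arrival_gap (\<lambda>t. N t \<omega>) i) \<in> borel_measurable M"
  using measurable_grid_index[of N M, OF assms] unfolding arrival_gap_def arrival_def by measurable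

lemma borel_measurable_arrival:
  assumes "\<And>t. 0 \<le> t \<Longrightarrow> N t \<in> measurable M (count_space UNIV)"
  shows "(\<lambda>\<omega>. arrival (\<lambda>t. N t \<omega>) i) \<in> borel_measurable M"
  using measurable_grid_index[of N M, OF assms] unfolding arrival_def by measurable

subsection \<open>Independence\<close>

context prob_space begin

lemma prob_tendsto_AE:
  assumes A: "\<And>k. A k \<in> events" and B: "B \<in> events"
    and ev: "AE \<omega> in M. \<forall>\<^sub>F k in sequentially. \<omega> \<in> A k \<longleftrightarrow> \<omega> \<in> B"
  shows "(\<lambda>k. prob (A k)) \<longlonglongrightarrow> prob B"
proof -
  have "(\<lambda>k. expectation (indicator (A k))) \<longlonglongrightarrow> expectation (indicator B :: 'a \<Rightarrow> real)"
  proof (rule integral_dominated_convergence[where w="\<lambda>_. 1"])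
    show "AE \<omega> in M. (\<lambda>k. indicator (A k) \<omega>) \<longlonglongrightarrow> (indicator B \<omega> :: real)"
      using ev by eventually_elim (auto intro!: tendsto_eventually elim!: eventually_mono simp: indicator_def)
  qed (use A B in \<open>auto simp: indicator_def\<close>)
  then show ?thesis using A B by simp
qed

text \<open>Right half-lines form an intersection-stable generator of the Borel sets. The almost
  sure lower bound \<open>b\<close> serves to reduce an arbitrary finite index set to an initial
  segment.\<close>

lemma indep_vars_Ioi:
  fixes X :: "nat \<Rightarrow> 'a \<Rightarrow> real"
  assumes X: "\<And>i. random_variable borel (X i)"
    and ind: "\<And>n a. prob {\<omega>\<in>space M. \<forall>i<n. a i < X i \<omega>} = (\<Prod>i<n. prob {\<omega>\<in>space M. a i < X i \<omega>})"
    and lo: "\<And>i. AE \<omega> in M. b < X i \<omega>"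
  shows "indep_vars (\<lambda>_. borel) X UNIV"
proof -
  define E where "E i = {X i -` A \<inter> space M |A. A \<in> range greaterThan}" for i
  have "indep_sets E UNIV"
  proof (rule indep_setsI)
    show "E i \<subseteq> events" for i using X[of i] by (auto simp: E_def intro!: measurable_sets)
    fix A J assume J: "J \<noteq> {}" "finite J" "\<forall>j\<in>J. A j \<in> E j"
    then have "\<forall>j\<in>J. \<exists>a. A j = {\<omega>\<in>space M. a < X j \<omega>}"
      by (fastforce simp: E_def)
    from bchoice[OF this] obtain a where a: "\<And>j. j \<in> J \<Longrightarrow> A j = {\<omega>\<in>space M. a j < X j \<omega>}" by blast
    obtain n where n: "J \<subseteq> {..<n}" using J(2) finite_nat_iff_bounded by blast
    \<comment> \<open>Indices outside \<open>J\<close> receive the threshold \<open>b\<close>, whose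
      event has probability one and changes neither the intersection, up to a null set, nor the
      product.\<close>
    define a' where "a' i = (if i \<in> J then a i else b)" for i
    have ones: "prob {\<omega>\<in>space M. b < X i \<omega>} = 1" for i
      using lo[of i] X[of i] by (subst prob_Collect_eq_1) auto
    have "prob (\<Inter>j\<in>J. A j) = prob {\<omega>\<in>space M. \<forall>i<n. a' i < X i \<omega>}"
    proof (rule measure_eq_AE)
      have "AE \<omega> in M. \<forall>i. b < X i \<omega>" using lo by (simp add: AE_all_countable)
      then show "AE \<omega> in M. (\<omega> \<in> (\<Inter>j\<in>J. A j)) = (\<omega> \<in> {\<omega>\<in>space M. \<forall>i<n. a' i < X i \<omega>})"
        using AE_space by eventually_elim (use n J in \<open>auto simp: a a'_def\<close>)
      show "(\<Inter>j\<in>J. A j) \<in> events" using J X by (intro sets.finite_INT) (auto simp: a)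
      show "{\<omega>\<in>space M. \<forall>i<n. a' i < X i \<omega>} \<in> events" using X by measurable
    qed
    also have "\<dots> = (\<Prod>i<n. prob {\<omega>\<in>space M. a' i < X i \<omega>})" by (rule ind)
    also have "\<dots> = (\<Prod>i\<in>J. prob {\<omega>\<in>space M. a' i < X i \<omega>})"
      by (rule prod.mono_neutral_right) (use n ones in \<open>auto simp: a'_def\<close>)
    finally show "prob (\<Inter>j\<in>J. A j) = (\<Prod>j\<in>J. prob (A j))" by (simp add: a a'_def)
  qed
  then have "indep_sets (\<lambda>i. sigma_sets (space M) (E i)) UNIV"
  proof (rule indep_sets_sigma)
    fix i show "Int_stable (E i)"
    proof (rule Int_stableI)
      fix A B assume "A \<in> E i" "B \<in> E i"
      then obtain a b where "A = X i -` {a<..} \<inter> space M" "B = X i -` {b<..} \<inter> space M" by (auto simp: E_def)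
      then have "A \<inter> B = X i -` {max a b<..} \<inter> space M" by auto
      then show "A \<inter> B \<in> E i" by (auto simp: E_def)
    qed
  qed
  moreover have "sigma_sets (space M) {X i -` A \<inter> space M |A. A \<in> sets borel} = sigma_sets (space M) (E i)" for i
  proof -
    have "sets borel = sigma_sets UNIV (range (greaterThan :: real \<Rightarrow> _))"
      by (simp add: borel_Ioi sets_measure_of_conv)
    then show ?thesis unfolding E_def
      by (simp only: sigma_sets_vimage_commute[of "X i" "space M" UNIV, simplified] sigma_sets_sigma_sets_eq)
         (subst sigma_sets_sigma_sets_eq, auto)
  qed
  ultimately show ?thesis unfolding indep_vars_def using X by simp
qed

text \<open>A finite intersection splits into a part in \<open>A\<close> and a part in
  \<open>B\<close>. Independence of the two \<sigma>-algebras separates the parts, and independence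
  within each family factorises them further.\<close>

lemma indep_vars_case_sum:
  assumes X: "indep_vars (\<lambda>_. N) X I" "\<And>i. i \<in> I \<Longrightarrow> X i \<in> measurable A N"
    and Y: "indep_vars (\<lambda>_. N) Y J" "\<And>j. j \<in> J \<Longrightarrow> Y j \<in> measurable B N"
    and AB: "indep_set (sets A) (sets B)" and sp: "space A = space M" "space B = space M"
  shows "indep_vars (\<lambda>_. N) (case_sum X Y) (I <+> J)"
  unfolding indep_vars_def2
proof (intro conjI ballI)
  fix i assume "i \<in> I <+> J"
  then show "random_variable N (case_sum X Y i)"
    using X(1) Y(1) by (auto simp: indep_vars_def)
next
  let ?F = "\<lambda>i. {case_sum X Y i -` S \<inter> space M |S. S \<in> sets N}"
  show "indep_sets ?F (I <+> J)"
  proof (rule indep_setsI)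
    fix i assume "i \<in> I <+> J"
    then show "?F i \<subseteq> events"
      using X(1) Y(1) by (auto simp: indep_vars_def intro!: measurable_sets)
  next
    fix E K assume K: "K \<noteq> {}" "K \<subseteq> I <+> J" "finite K" "\<forall>k\<in>K. E k \<in> ?F k"
    define K1 where "K1 = Inl -` K"
    define K2 where "K2 = Inr -` K"
    have Keq: "K = K1 <+> K2"
      using K(2) by (auto simp: K1_def K2_def Plus_def image_iff)
    have sub: "K1 \<subseteq> I" "K2 \<subseteq> J" using K(2) by (auto simp: K1_def K2_def)
    have fin: "finite K1" "finite K2" using K(3) by (auto simp: K1_def K2_def intro!: finite_vimageI)
    have indX: "indep_sets (\<lambda>i. {X i -` S \<inter> space M |S. S \<in> sets N}) I"
      and indY: "indep_sets (\<lambda>i. {Y i -` S \<inter> space M |S. S \<in> sets N}) J"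
      using X(1) Y(1) by (auto simp: indep_vars_def2)
    \<comment> \<open>The intersection with \<open>space M\<close> gives the whole space, of
      probability one, when one of the index sets is empty.\<close>
    define E1 where "E1 = space M \<inter> (\<Inter>i\<in>K1. E (Inl i))"
    define E2 where "E2 = space M \<inter> (\<Inter>i\<in>K2. E (Inr i))"
    have EX: "E (Inl i) \<in> {X i -` S \<inter> space M |S. S \<in> sets N}" if "i \<in> K1" for i
      using K(4) that by (force simp: K1_def)
    have EY: "E (Inr i) \<in> {Y i -` S \<inter> space M |S. S \<in> sets N}" if "i \<in> K2" for i
      using K(4) that by (force simp: K2_def)
    have p1: "prob E1 = (\<Prod>i\<in>K1. prob (E (Inl i)))"
    proof (cases "K1 = {}")
      case False
      then have "E1 = (\<Inter>i\<in>K1. E (Inl i))" using EX by (fastforce simp: E1_def)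
      then show ?thesis using indep_setsD[OF indX sub(1) False fin(1), of "\<lambda>i. E (Inl i)"] EX by auto
    qed (simp add: E1_def prob_space)
    have p2: "prob E2 = (\<Prod>i\<in>K2. prob (E (Inr i)))"
    proof (cases "K2 = {}")
      case False
      then have "E2 = (\<Inter>i\<in>K2. E (Inr i))" using EY by (fastforce simp: E2_def)
      then show ?thesis using indep_setsD[OF indY sub(2) False fin(2), of "\<lambda>i. E (Inr i)"] EY by auto
    qed (simp add: E2_def prob_space)
    have "E (Inl i) \<in> sets A" if "i \<in> K1" for i
      using EX[OF that] X(2)[of i] sub that by (auto simp: sp(1)[symmetric] intro!: measurable_sets)
    then have "E1 \<in> sets A"
      unfolding E1_def sp(1)[symmetric] using fin(1) by (cases "K1 = {}") (auto intro!: sets.Int sets.finite_INT)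
    moreover have "E (Inr i) \<in> sets B" if "i \<in> K2" for i
      using EY[OF that] Y(2)[of i] sub that by (auto simp: sp(2)[symmetric] intro!: measurable_sets)
    then have "E2 \<in> sets B"
      unfolding E2_def sp(2)[symmetric] using fin(2) by (cases "K2 = {}") (auto intro!: sets.Int sets.finite_INT)
    ultimately have "prob (E1 \<inter> E2) = prob E1 * prob E2" by (rule indep_setD[OF AB])
    moreover have "(\<Inter>k\<in>K. E k) = E1 \<inter> E2"
      using K(1) EX EY unfolding Keq E1_def E2_def by fastforce
    ultimately show "prob (\<Inter>k\<in>K. E k) = (\<Prod>k\<in>K. prob (E k))"
      using fin p1 p2 unfolding Keq by (simp add: prod.Plus)
  qed
qed

end

subsection \<open>Interarrival times of the Poisson process\<close>

context drawdown_model begin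

declare space_F [simp]

lemma N_measurable_F: "0 \<le> s \<Longrightarrow> s \<le> t \<Longrightarrow> N s \<in> measurable (F t) (count_space UNIV)"
  by (rule subsetD[OF measurable_mono claims_adapted(1)[of s]]) (auto dest: sets_F_mono)

lemma F_events: "A \<in> sets (F t) \<Longrightarrow> A \<in> sets P"
  using filtration_sub by auto

lemma N_measurable [measurable]: "0 \<le> t \<Longrightarrow> N t \<in> measurable P (count_space UNIV)"
  by (rule subsetD[OF measurable_mono claims_adapted(1)[of t]]) (use filtration_sub in auto)

lemma increment_prob:
  assumes "0 \<le> s" "s < t"
  shows "P.prob {\<omega>\<in>space P. N t \<omega> - N s \<omega> \<in> S} = measure (poisson_pmf (lam * (t - s))) S"
proof -
  have [measurable]: "N s \<in> measurable P (count_space UNIV)" "N t \<in> measurable P (count_space UNIV)"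
    using assms by (auto intro: N_measurable)
  have "measure (distr P (count_space UNIV) (\<lambda>\<omega>. N t \<omega> - N s \<omega>)) S
      = P.prob ((\<lambda>\<omega>. N t \<omega> - N s \<omega>) -` S \<inter> space P)"
    by (subst measure_distr) auto
  then show ?thesis unfolding poisson_increments[OF assms]
    by (simp add: vimage_def Int_def conj_commute)
qed

text \<open>The model asserts independence of the joint increment of count and claims from the past;
  the slice {0} x UNIV extracts the count. Subtraction is truncated, so the event literally says
  \<open>N t \<le> N s\<close>.\<close>

lemma increment_indep:
  assumes st: "0 \<le> s" "s < t" and A: "A \<in> sets (F s)"
  shows "P.prob (A \<inter> {\<omega>\<in>space P. N t \<omega> - N s \<omega> = 0}) = P.prob A * exp (- lam * (t - s))"
proof -
  let ?f = "\<lambda>\<omega>. (N t \<omega> - N s \<omega>, aggregate_claims N Z t \<omega> - aggregate_claims N Z s \<omega>)"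
  have "?f -` ({0} \<times> UNIV) \<inter> space P \<in> sets (vimage_algebra (space P) ?f (count_space UNIV \<Otimes>\<^sub>M borel))"
    by (rule in_vimage_algebra) simp
  moreover have "?f -` ({0} \<times> UNIV) \<inter> space P = {\<omega>\<in>space P. N t \<omega> - N s \<omega> = 0}"
    by auto
  ultimately have "P.prob (A \<inter> {\<omega>\<in>space P. N t \<omega> - N s \<omega> = 0})
      = P.prob A * P.prob {\<omega>\<in>space P. N t \<omega> - N s \<omega> \<in> {0}}"
    using P.indep_setD[OF increments_indep_past[OF st] A] by simp
  also have "P.prob {\<omega>\<in>space P. N t \<omega> - N s \<omega> \<in> {0}} = exp (- lam * (t - s))"
    unfolding increment_prob[OF st] using market.lambda_pos st by (simp add: measure_pmf_single)
  finally show ?thesis .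
qed

text \<open>If the count stays below \<open>i\<close>, then so does the increment over [0, n] for
  every n, and the Poisson mass below \<open>i\<close> vanishes as the mean lam * n grows.\<close>

lemma AE_unbounded: "AE \<omega> in P. \<forall>i. \<exists>t\<ge>0. i \<le> N t \<omega>"
proof (subst AE_all_countable, intro allI)
  fix i
  let ?B = "{\<omega>\<in>space P. \<forall>n::nat. N (real n) \<omega> < i}"
  have B: "?B \<in> P.events" by measurable
  have lim: "(\<lambda>n. \<Sum>j<i. pmf (poisson_pmf (lam * real n)) j) \<longlonglongrightarrow> (\<Sum>j<i. 0)"
  proof (intro tendsto_sum)
    fix j
    have "filterlim (\<lambda>n. lam * real n) at_top sequentially"
      using market.lambda_pos by (intro filterlim_tendsto_pos_mult_at_top[OF tendsto_const] filterlim_real_sequentially)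
    from tendsto_divide[OF filterlim_compose[OF tendsto_power_div_exp_0 this, of j] tendsto_const[of "fact j"]]
    have "(\<lambda>n. (lam * real n) ^ j / fact j * exp (- (lam * real n))) \<longlonglongrightarrow> 0"
      by (simp add: exp_minus field_simps)
    moreover have "\<forall>\<^sub>F n in sequentially. pmf (poisson_pmf (lam * real n)) j = (lam * real n) ^ j / fact j * exp (- (lam * real n))"
      using eventually_gt_at_top[of 0] by eventually_elim (use market.lambda_pos in auto)
    ultimately show "(\<lambda>n. pmf (poisson_pmf (lam * real n)) j) \<longlonglongrightarrow> 0"
      by (simp add: tendsto_cong)
  qed
  have "P.prob ?B \<le> (\<Sum>j<i. pmf (poisson_pmf (lam * real n)) j)" if "n > 0" for n :: nat
  proof -
    \<comment> \<open>Truncated subtraction only lowers the count, so this inclusion holds for every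
      outcome, irrespective of the value of \<open>N 0\<close>.\<close>
    have "P.prob ?B \<le> P.prob {\<omega>\<in>space P. N (real n) \<omega> - N 0 \<omega> \<in> {..<i}}"
      by (rule P.finite_measure_mono) (auto intro: le_less_trans[OF diff_le_self])
    also have "\<dots> = (\<Sum>j<i. pmf (poisson_pmf (lam * real n)) j)"
      using that by (subst increment_prob) (auto simp: measure_measure_pmf_finite)
    finally show ?thesis .
  qed
  then have "P.prob ?B \<le> (\<Sum>j<i. 0)"
    by (intro LIMSEQ_le_const[OF lim] exI[of _ 1]) auto
  then have "P.prob ?B = 0" by (simp add: measure_le_0_iff)
  then have "AE \<omega> in P. \<omega> \<notin> ?B" using B by (simp add: P.prob_eq_0)
  then have "AE \<omega> in P. \<not> (\<forall>n::nat. N (real n) \<omega> < i)"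
    using AE_space by eventually_elim auto
  then show "AE \<omega> in P. \<exists>t\<ge>0. i \<le> N t \<omega>"
    by eventually_elim (metis not_less of_nat_0_le_iff)
qed

lemma AE_counting_path: "AE \<omega> in P. counting_path (\<lambda>t. N t \<omega>)"
  using counting_paths AE_unbounded by eventually_elim (auto simp: counting_path_def)

abbreviation gap :: "nat \<Rightarrow> 'a \<Rightarrow> real" where
  "gap i \<omega> \<equiv> arrival_gap (\<lambda>t. N t \<omega>) i"

lemma gap_measurable [measurable]: "gap i \<in> borel_measurable P"
  by (intro borel_measurable_arrival_gap N_measurable)

lemma arrival_measurable [measurable]: "(\<lambda>\<omega>. arrival (\<lambda>t. N t \<omega>) i) \<in> borel_measurable P"
  by (intro borel_measurable_arrival N_measurable)

text \<open>With r = lam * (t - s), the bound exp (- r) >= 1 - r gives 1 - exp (- r) * (1 + r) <= r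
  * r. The square is essential: the number of grid cells in a bounded interval grows only like the
  inverse of the mesh, so the total still tends to 0.\<close>

lemma two_claims_prob:
  assumes "0 \<le> s" "s < t"
  shows "P.prob {\<omega>\<in>space P. 2 \<le> N t \<omega> - N s \<omega>} \<le> (lam * (t - s))\<^sup>2"
proof -
  define r where "r = lam * (t - s)"
  have r: "0 < r" using assms market.lambda_pos by (simp add: r_def)
  have "{2..} = space (measure_pmf (poisson_pmf r)) - {0, 1 :: nat}" by auto
  then have "measure (poisson_pmf r) {2..} = 1 - measure (poisson_pmf r) {0, 1}"
    using measure_pmf.prob_compl[of "{0, 1}" "poisson_pmf r"] by simp
  also have "\<dots> = 1 - exp (- r) * (1 + r)"
    using r by (subst measure_measure_pmf_finite) (auto simp: algebra_simps)
  also have "\<dots> \<le> 1 - (1 - r) * (1 + r)"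
    using r exp_ge_add_one_self[of "- r"] by (intro diff_left_mono mult_right_mono) auto
  finally show ?thesis
    using increment_prob[OF assms, of "{2..}"] unfolding r_def[symmetric] power2_eq_square
    by (simp add: algebra_simps)
qed

text \<open>Two simultaneous arrivals would put two claims into one cell of every dyadic grid.\<close>

lemma AE_gap_pos: "AE \<omega> in P. 0 < gap n \<omega>"
proof -
  \<comment> \<open>The cut-off at \<open>J\<close> leaves finitely many cells on each grid; it is
    removed at the end by countably many exceptional null sets.\<close>
  have "AE \<omega> in P. \<not> (gap n \<omega> \<le> 0 \<and> arrival (\<lambda>t. N t \<omega>) n \<le> real J)" for J :: nat
  proof -
    let ?B = "{\<omega>\<in>space P. gap n \<omega> \<le> 0 \<and> arrival (\<lambda>t. N t \<omega>) n \<le> real J}"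
    have B: "?B \<in> P.events" by measurable
    have bound: "P.prob ?B \<le> real J * lam\<^sup>2 * (1 / 2) ^ k" for k
    proof -
      let ?E = "\<lambda>j. {\<omega>\<in>space P. 2 \<le> N (real (Suc j) / 2 ^ k) \<omega> - N (real j / 2 ^ k) \<omega>}"
      have E: "?E j \<in> P.events" for j by measurable
      have "AE \<omega> in P. \<omega> \<in> ?B \<longrightarrow> \<omega> \<in> (\<Union>j<J * 2 ^ k. ?E j)"
        using AE_counting_path
      proof eventually_elim
        fix \<omega> assume f: "counting_path (\<lambda>t. N t \<omega>)"
        let ?f = "\<lambda>t. N t \<omega>"
        show "\<omega> \<in> ?B \<longrightarrow> \<omega> \<in> (\<Union>j<J * 2 ^ k. ?E j)"
        proof
          assume w: "\<omega> \<in> ?B"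
          have f0: "N 0 \<omega> = 0" using f by (simp add: counting_path_def)
          have same: "arrival ?f (Suc n) \<le> arrival ?f n" using w by (simp add: arrival_gap_def)
          \<comment> \<open>The cells are open on the left and miss time 0;
            \<open>N 0 \<omega> = 0\<close> excludes simultaneous arrivals there.\<close>
          have pos: "0 < arrival ?f n"
            using counting_path_arrival(2)[OF f, of 0 "Suc n"] f0 same by simp
          define g where "g = grid_index ?f n k"
          have g: "arrival ?f n \<le> real g / 2 ^ k" "real g / 2 ^ k < arrival ?f n + 1 / 2 ^ k"
            using counting_path_grid(1,2)[OF f, of n k] unfolding g_def by auto
          have "g \<noteq> 0" using pos g(1) by (cases g) auto
          then obtain j where j: "g = Suc j" by (cases g) auto
          have lt: "real j / 2 ^ k < arrival ?f n" using g(2) j by (simp add: add_divide_distrib)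
          have "N (real j / 2 ^ k) \<omega> < n"
            using counting_path_arrival(2)[OF f, of "real j / 2 ^ k" n] lt by auto
          moreover have "Suc n \<le> N (real (Suc j) / 2 ^ k) \<omega>"
            using counting_path_arrival(2)[OF f, of "real g / 2 ^ k" "Suc n"] g(1) same j by auto
          moreover have "real j / 2 ^ k < real J" using lt w by auto
          then have "real j < real (J * 2 ^ k)" by (simp add: field_simps)
          then have "j < J * 2 ^ k" by linarith
          ultimately show "\<omega> \<in> (\<Union>j<J * 2 ^ k. ?E j)" using w by (intro UN_I[of j]) auto
        qed
      qed
      then have "P.prob ?B \<le> P.prob (\<Union>j<J * 2 ^ k. ?E j)"
        using E by (intro P.finite_measure_mono_AE) auto
      also have "\<dots> \<le> (\<Sum>j<J * 2 ^ k. P.prob (?E j))"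
        using E by (intro P.finite_measure_subadditive_finite) auto
      also have "\<dots> \<le> (\<Sum>j<J * 2 ^ k. (lam / 2 ^ k)\<^sup>2)"
      proof (rule sum_mono)
        fix j
        have "real (Suc j) / 2 ^ k - real j / 2 ^ k = (1::real) / 2 ^ k" by (simp add: diff_divide_distrib[symmetric])
        then show "P.prob (?E j) \<le> (lam / 2 ^ k)\<^sup>2"
          using two_claims_prob[of "real j / 2 ^ k" "real (Suc j) / 2 ^ k"] by (simp add: divide_strict_right_mono)
      qed
      also have "\<dots> = real J * lam\<^sup>2 * (1 / 2) ^ k"
        by (simp add: power2_eq_square power_one_over)
      finally show ?thesis .
    qed
    have "(\<lambda>k. real J * lam\<^sup>2 * (1 / 2) ^ k) \<longlonglongrightarrow> real J * lam\<^sup>2 * 0"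
      by (intro tendsto_mult tendsto_const LIMSEQ_power_zero) simp
    then have "P.prob ?B \<le> 0" using bound LIMSEQ_le_const[of _ "real J * lam\<^sup>2 * 0" "P.prob ?B"] by simp
    then have "P.prob ?B = 0" by (simp add: measure_le_0_iff)
    then have "AE \<omega> in P. \<omega> \<notin> ?B" using B by (simp add: P.prob_eq_0)
    then show ?thesis using AE_space by eventually_elim auto
  qed
  then have "AE \<omega> in P. \<forall>J::nat. \<not> (gap n \<omega> \<le> 0 \<and> arrival (\<lambda>t. N t \<omega>) n \<le> real J)"
    unfolding AE_all_countable by blast
  then show ?thesis
  proof eventually_elim
    case (elim \<omega>)
    then show ?case using real_arch_simple[of "arrival (\<lambda>t. N t \<omega>) n"] by (meson not_le)
  qed
qed

text \<open>The strong Markov property at the \<open>n\<close>-th arrival, by approximation with dyadic times from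
  above.\<close>

lemma gap_memoryless:
  assumes s: "0 < s"
  shows "P.prob {\<omega>\<in>space P. (\<forall>i<n. a i < gap i \<omega>) \<and> s < gap n \<omega>}
       = exp (- lam * s) * P.prob {\<omega>\<in>space P. \<forall>i<n. a i < gap i \<omega>}"
proof -
  let ?A = "\<lambda>\<omega>. \<forall>i<n. a i < gap i \<omega>"
  let ?f = "\<lambda>\<omega> t. N t \<omega>"
  let ?U = "\<lambda>k \<omega>. real (grid_index (?f \<omega>) n k) / 2 ^ k"
  let ?D = "\<lambda>k e. {\<omega>\<in>space P. ?A \<omega> \<and> ?U k \<omega> + e < arrival (?f \<omega>) (Suc n)}"
  have [measurable]: "?U k \<in> borel_measurable P" for k
    using measurable_grid_index[of N P n k, OF N_measurable] by measurable
  have D: "?D k e \<in> P.events" for k e by measurable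
  have grid: "P.prob (?D k s) = exp (- lam * s) * P.prob (?D k 0)" for k
  proof -
    define q where "q j = real j / 2 ^ k" for j :: nat
    have q0: "0 \<le> q j" for j by (simp add: q_def)
    \<comment> \<open>\<open>A j\<close> says that \<open>q j\<close> is the first grid time with at
      least \<open>n\<close> claims and that the next claim has not yet come. The gaps are evaluated
      on the path stopped at \<open>q j\<close>, which puts \<open>A j\<close> into
      \<open>F (q j)\<close>; by \<open>arrival_stopped\<close> they are almost surely the true gaps
      on \<open>A j\<close>.\<close>
    define A where "A j = {\<omega>\<in>space P. (\<forall>i<n. a i < arrival_gap (\<lambda>t. N (min t (q j)) \<omega>) i)
        \<and> N (q j) \<omega> = n \<and> (\<forall>j'<j. N (q j') \<omega> < n)}" for j
    define B where "B j e = A j \<inter> {\<omega>\<in>space P. N (q j + e) \<omega> - N (q j) \<omega> = 0}" for j e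
    have A: "A j \<in> sets (F (q j))" for j
    proof -
      have [measurable]: "N (min t (q j)) \<in> measurable (F (q j)) (count_space UNIV)" if "0 \<le> t" for t
        using that q0 by (intro N_measurable_F) auto
      have [measurable]: "(\<lambda>\<omega>. arrival_gap (\<lambda>t. N (min t (q j)) \<omega>) i) \<in> borel_measurable (F (q j))" for i
        by (rule borel_measurable_arrival_gap) measurable
      have [measurable]: "N (q j') \<in> measurable (F (q j)) (count_space UNIV)" if "j' \<le> j" for j'
        using that q0 by (intro N_measurable_F) (auto simp: q_def divide_right_mono)
      have "A j = {\<omega>\<in>space (F (q j)). (\<forall>i<n. a i < arrival_gap (\<lambda>t. N (min t (q j)) \<omega>) i)
        \<and> N (q j) \<omega> = n \<and> (\<forall>j'\<in>{..<j}. N (q j') \<omega> < n)}" by (auto simp: A_def)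
      also have "\<dots> \<in> sets (F (q j))" 
        by (intro sets.sets_Collect_conj sets.sets_Collect_finite_All) measurable
      finally show ?thesis .
    qed
    have Bm: "B j e \<in> P.events" if "0 \<le> e" for j e
    proof -
      have [measurable]: "N (q j + e) \<in> measurable P (count_space UNIV)" "N (q j) \<in> measurable P (count_space UNIV)"
        using that q0 by (auto intro!: N_measurable add_nonneg_nonneg)
      have "{\<omega>\<in>space P. N (q j + e) \<omega> - N (q j) \<omega> = 0} \<in> P.events" by measurable
      then show ?thesis unfolding B_def using F_events[OF A] by (rule sets.Int[rotated])
    qed
    have lt: "\<not> i < j" if "\<omega> \<in> B i e" "\<omega> \<in> B j e" for i j e \<omega>
      using that by (auto simp: B_def A_def)
    then have disj: "disjoint_family (\<lambda>j. B j e)" for e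
      unfolding disjoint_family_on_def by (metis disjoint_iff linorder_neqE_nat)
    have Bsums: "(\<lambda>j. P.prob (B j e)) sums P.prob (\<Union>j. B j e)" if "0 \<le> e" for e
      using Bm[OF that] by (intro P.finite_measure_UNION disj) blast
    have DB: "P.prob (?D k e) = (\<Sum>j. P.prob (B j e))" if e: "0 \<le> e" for e
    proof -
      have "P.prob (?D k e) = P.prob (\<Union>j. B j e)"
      proof (rule measure_eq_AE)
        show "(\<Union>j. B j e) \<in> P.events" using Bm[OF e] by blast
        show "AE \<omega> in P. (\<omega> \<in> ?D k e) = (\<omega> \<in> (\<Union>j. B j e))"
          using AE_counting_path AE_space
        proof eventually_elim
          case (elim \<omega>)
          note f = elim(1)
          define g where "g = grid_index (?f \<omega>) n k"
          have Tg: "arrival (?f \<omega>) n \<le> q g" using counting_path_grid(1)[OF f] by (simp add: g_def q_def)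
          then have ng: "n \<le> N (q g) \<omega>" using counting_path_arrival(2)[OF f q0] by simp
          have before: "N (q j') \<omega> < n" if "j' < g" for j'
            using not_less_Least[OF that[unfolded g_def grid_index_def]] by (simp add: q_def)
          have stop: "arrival_gap (\<lambda>t. N (min t (q g)) \<omega>) i = gap i \<omega>" if "i < n" for i
            using arrival_stopped[OF f q0, of _ g] ng that by (simp add: arrival_gap_def)
          have mono: "N (q g) \<omega> \<le> N (q g + e) \<omega>"
            using f q0[of g] e by (auto simp: counting_path_def mono_on_def)
          have only: "j = g" if "\<omega> \<in> B j e" for j
          proof (rule ccontr)
            assume "j \<noteq> g"
            then consider "j < g" | "g < j" by linarith
            then show False using that before[of j] ng by cases (auto simp: B_def A_def)
          qed
          have "\<omega> \<in> (\<Union>j. B j e) \<longleftrightarrow> \<omega> \<in> B g e" using only by blast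
          also have "\<dots> \<longleftrightarrow> ?A \<omega> \<and> N (q g + e) \<omega> \<le> n"
            using elim(2) before ng stop mono by (auto simp: B_def A_def)
          also have "N (q g + e) \<omega> \<le> n \<longleftrightarrow> q g + e < arrival (?f \<omega>) (Suc n)"
            using counting_path_arrival(2)[OF f, of "q g + e" "Suc n"] q0[of g] e by auto
          finally show ?case using elim(2) by (simp add: g_def q_def)
        qed
      qed (rule D)
      also have "\<dots> = (\<Sum>j. P.prob (B j e))"
        using Bsums[OF e] by (rule sums_unique)
      finally show ?thesis .
    qed
    have step: "P.prob (B j s) = exp (- lam * s) * P.prob (B j 0)" for j
    proof -
      have "B j 0 = A j" unfolding B_def using sets.sets_into_space[OF A, of j] by auto
      moreover have "P.prob (B j s) = P.prob (A j) * exp (- lam * (q j + s - q j))"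
        unfolding B_def by (rule increment_indep[OF q0 _ A]) (use s in simp)
      ultimately show ?thesis by simp
    qed
    have "summable (\<lambda>j. P.prob (B j 0))"
      using Bsums[of 0] by (rule sums_summable) simp
    then have "(\<Sum>j. exp (- lam * s) * P.prob (B j 0)) = exp (- lam * s) * (\<Sum>j. P.prob (B j 0))"
      by (rule suminf_mult)
    then show ?thesis unfolding DB[OF less_imp_le[OF s]] DB[OF order_refl] step .
  qed
  \<comment> \<open>The grid times approach the \<open>n\<close>-th arrival from above and the
    inequality is strict, so on a counting path membership is constant for all large
    \<open>k\<close>.\<close>
  have lim: "(\<lambda>k. P.prob (?D k e)) \<longlonglongrightarrow> P.prob {\<omega>\<in>space P. ?A \<omega> \<and> e < gap n \<omega>}" for e
  proof (rule P.prob_tendsto_AE[OF D])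
    show "{\<omega>\<in>space P. ?A \<omega> \<and> e < gap n \<omega>} \<in> P.events" by measurable
    show "AE \<omega> in P. \<forall>\<^sub>F k in sequentially. (\<omega> \<in> ?D k e) = (\<omega> \<in> {\<omega>\<in>space P. ?A \<omega> \<and> e < gap n \<omega>})"
      using AE_counting_path AE_space
    proof eventually_elim
      case (elim \<omega>)
      note T = counting_path_grid[OF elim(1), of n]
      show ?case
      proof (cases "e < gap n \<omega>")
        case True
        then have "arrival (?f \<omega>) n < arrival (?f \<omega>) (Suc n) - e" by (simp add: arrival_gap_def)
        from order_tendstoD(2)[OF T(3) this] show ?thesis
          by eventually_elim (use True in auto)
      next
        case False
        then have "\<not> ?U k \<omega> + e < arrival (?f \<omega>) (Suc n)" for k
          using T(1)[of k] by (simp add: arrival_gap_def)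
        then show ?thesis using False by simp
      qed
    qed
  qed
  \<comment> \<open>The grid identity refers to \<open>e = 0\<close> on its right side. The
    condition that this leaves in the limit, a positive gap, holds almost surely.\<close>
  have "P.prob {\<omega>\<in>space P. ?A \<omega> \<and> s < gap n \<omega>} = exp (- lam * s) * P.prob {\<omega>\<in>space P. ?A \<omega> \<and> 0 < gap n \<omega>}"
    using LIMSEQ_unique[OF lim[of s, unfolded grid] tendsto_mult_left[OF lim[of 0]]] .
  also have "P.prob {\<omega>\<in>space P. ?A \<omega> \<and> 0 < gap n \<omega>} = P.prob {\<omega>\<in>space P. ?A \<omega>}"
  proof (rule measure_eq_AE)
    show "AE \<omega> in P. (\<omega> \<in> {\<omega>\<in>space P. ?A \<omega> \<and> 0 < gap n \<omega>}) = (\<omega> \<in> {\<omega>\<in>space P. ?A \<omega>})"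
      using AE_gap_pos[of n] by eventually_elim auto
  qed measurable
  finally show ?thesis .
qed

section \<open>Exponential law and independence of the interarrival times\<close>

lemma gap_step:
  "P.prob {\<omega>\<in>space P. (\<forall>i<n. a i < gap i \<omega>) \<and> s < gap n \<omega>}
     = (if s < 0 then 1 else exp (- lam * s)) * P.prob {\<omega>\<in>space P. \<forall>i<n. a i < gap i \<omega>}"
proof (cases "0 < s")
  case True
  then show ?thesis using gap_memoryless[of s n a] by simp
next
  case False
  have "P.prob {\<omega>\<in>space P. (\<forall>i<n. a i < gap i \<omega>) \<and> s < gap n \<omega>} = P.prob {\<omega>\<in>space P. \<forall>i<n. a i < gap i \<omega>}"
  proof (rule measure_eq_AE)
    show "AE \<omega> in P. (\<omega> \<in> {\<omega>\<in>space P. (\<forall>i<n. a i < gap i \<omega>) \<and> s < gap n \<omega>}) = (\<omega> \<in> {\<omega>\<in>space P. \<forall>i<n. a i < gap i \<omega>})"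
      using AE_gap_pos[of n] by eventually_elim (use False in auto)
  qed measurable
  then show ?thesis using False by (cases "s = 0") auto
qed

lemma gap_survival: "P.prob {\<omega>\<in>space P. s < gap n \<omega>} = (if s < 0 then 1 else exp (- lam * s))"
proof -
  \<comment> \<open>The thresholds -1 make the constraint on the earlier gaps an almost sure
    event.\<close>
  have "P.prob {\<omega>\<in>space P. \<forall>i<n. - 1 < gap i \<omega>} = 1"
  proof (subst P.prob_Collect_eq_1)
    show "AE \<omega> in P. \<forall>i<n. - 1 < gap i \<omega>"
    proof -
      have "AE \<omega> in P. \<forall>i. 0 < gap i \<omega>" using AE_gap_pos by (simp add: AE_all_countable)
      then show ?thesis by eventually_elim (auto intro: less_trans[of _ 0])
    qed
  qed measurable
  moreover have "P.prob {\<omega>\<in>space P. (\<forall>i<n. - 1 < gap i \<omega>) \<and> s < gap n \<omega>} = P.prob {\<omega>\<in>space P. s < gap n \<omega>}"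
  proof (rule measure_eq_AE)
    have "AE \<omega> in P. \<forall>i. 0 < gap i \<omega>" using AE_gap_pos by (simp add: AE_all_countable)
    then show "AE \<omega> in P. (\<omega> \<in> {\<omega>\<in>space P. (\<forall>i<n. - 1 < gap i \<omega>) \<and> s < gap n \<omega>}) = (\<omega> \<in> {\<omega>\<in>space P. s < gap n \<omega>})"
      by eventually_elim (auto intro: less_trans[of _ 0])
  qed measurable
  ultimately show ?thesis using gap_step[of n "\<lambda>_. - 1" s] by simp
qed

lemma gap_indep: "P.indep_vars (\<lambda>_. borel) gap UNIV"
proof (rule P.indep_vars_Ioi)
  show "P.prob {\<omega>\<in>space P. \<forall>i<n. a i < gap i \<omega>} = (\<Prod>i<n. P.prob {\<omega>\<in>space P. a i < gap i \<omega>})" for n a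
  proof (induction n)
    case 0
    show ?case by (simp add: P.prob_space)
  next
    case (Suc n)
    have "{\<omega>\<in>space P. \<forall>i<Suc n. a i < gap i \<omega>} = {\<omega>\<in>space P. (\<forall>i<n. a i < gap i \<omega>) \<and> a n < gap n \<omega>}"
      by (auto simp: less_Suc_eq)
    then show ?case using Suc gap_step[of n a "a n"] by (simp add: gap_survival mult.commute)
  qed
  show "AE \<omega> in P. - 1 < gap i \<omega>" for i
    using AE_gap_pos[of i] by eventually_elim simp
qed measurable

lemma gap_distributed: "distributed P lborel (gap n) (exponential_density lam)"
proof -
  have "P.prob {\<omega>\<in>space P. gap n \<omega> \<le> a} = 1 - exp (- a * lam)" if "0 \<le> a" for a
  proof -
    have "P.prob {\<omega>\<in>space P. gap n \<omega> \<le> a} = P.prob (space P - {\<omega>\<in>space P. a < gap n \<omega>})"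
      by (intro arg_cong[where f=P.prob]) auto
    also have "\<dots> = 1 - exp (- a * lam)"
      using that by (subst P.prob_compl) (auto simp: gap_survival mult.commute)
    finally show ?thesis .
  qed
  then show ?thesis
    by (subst P.exponential_distributed_iff[OF market.lambda_pos]) auto
qed

lemma distr_gap: "distr P borel (gap n) = density lborel (exponential_density lam)"
  using distributed_distr_eq_density[OF gap_distributed[of n]] by (simp cong: distr_cong)

lemma claim_measurable [measurable]: "Z n \<in> borel_measurable P"
  using claim_sizes_indep by (auto simp: P.indep_vars_def)

text \<open>One family over a sum type: disjoint index sets then give both the independence of
  waiting time and size of one claim and the independence of that pair from the past.\<close>

definition shock :: "nat + nat \<Rightarrow> 'a \<Rightarrow> real" where
  "shock = case_sum gap Z"

text \<open>The gaps consult the counting variables at countably many times only, so they are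
  measurable for the \<sigma>-algebra \<open>?A\<close> of the arrivals, which the model declares
  independent of the claim sizes.\<close>

lemma shock_indep: "P.indep_vars (\<lambda>_. borel) shock UNIV"
proof -
  let ?A = "vimage_algebra (space P) (\<lambda>\<omega>. \<lambda>t\<in>{0..}. N t \<omega>) (\<Pi>\<^sub>M t\<in>{0..}. count_space UNIV)"
  let ?B = "vimage_algebra (space P) (\<lambda>\<omega> n. Z n \<omega>) (\<Pi>\<^sub>M n\<in>UNIV. borel)"
  have "P.indep_vars (\<lambda>_. borel) (case_sum gap Z) (UNIV <+> UNIV)"
  proof (rule P.indep_vars_case_sum[OF gap_indep _ claim_sizes_indep _ claim_sizes_indep_arrivals])
    have "N t \<in> measurable ?A (count_space UNIV)" if "0 \<le> t" for t
    proof -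
      have "(\<lambda>\<omega>. \<lambda>t\<in>{0..}. N t \<omega>) \<in> measurable ?A (\<Pi>\<^sub>M t\<in>{0..}. count_space UNIV)"
        by (rule measurable_vimage_algebra1) (auto simp: space_PiM)
      from measurable_compose[OF this measurable_component_singleton[of t]] that
      show ?thesis by simp
    qed
    then show "gap i \<in> borel_measurable ?A" for i by (rule borel_measurable_arrival_gap)
    show "Z j \<in> borel_measurable ?B" for j
    proof -
      have "(\<lambda>\<omega> n. Z n \<omega>) \<in> measurable ?B (\<Pi>\<^sub>M n\<in>UNIV. borel)"
        by (rule measurable_vimage_algebra1) (auto simp: space_PiM)
      from measurable_compose[OF this measurable_component_singleton[of j]]
      show ?thesis by simp
    qed
  qed auto
  then show ?thesis by (simp add: shock_def)
qed

end

subsection \<open>Chains driven by the claims\<close>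

text \<open>The shock sequence \<open>f\<close> lists interarrival times (left summand) and claim sizes (right).\<close>

primrec chain :: "('s \<Rightarrow> real \<Rightarrow> real \<Rightarrow> 's) \<Rightarrow> 's \<Rightarrow> (nat + nat \<Rightarrow> real) \<Rightarrow> nat \<Rightarrow> 's" where
  "chain step s f 0 = s"
| "chain step s f (Suc n) = step (chain step s f n) (f (Inl n)) (f (Inr n))"

text \<open>Used to replace the shocks by their restriction to the indices below
  \<open>n\<close>.\<close>

lemma chain_cong:
  "(\<And>i. i < n \<Longrightarrow> f (Inl i) = g (Inl i) \<and> f (Inr i) = g (Inr i)) \<Longrightarrow> chain step s f n = chain step s g n"
  by (induction n) auto

lemma chain_invariant:
  "I s \<Longrightarrow> (\<And>s t z. I s \<Longrightarrow> I (step s t z)) \<Longrightarrow> I (chain step s f n)"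
  by (induction n) auto

lemma measurable_chain:
  assumes step: "(\<lambda>(s, t, z). step s t z) \<in> measurable (S \<Otimes>\<^sub>M borel \<Otimes>\<^sub>M borel) S" and s: "s \<in> space S"
    and J: "Inl ` {..<n} \<subseteq> J" "Inr ` {..<n} \<subseteq> J"
  shows "(\<lambda>f. chain step s f n) \<in> measurable (PiM J (\<lambda>_. borel)) S"
  using J
proof (induction n)
  case 0
  show ?case using s by simp
next
  case (Suc n)
  then have [measurable]: "(\<lambda>f. chain step s f n) \<in> measurable (PiM J (\<lambda>_. borel)) S"
    by (auto simp: lessThan_Suc)
  have [measurable]: "(\<lambda>f. f (Inl n)) \<in> borel_measurable (PiM J (\<lambda>_. borel))"
    "(\<lambda>f. f (Inr n)) \<in> borel_measurable (PiM J (\<lambda>_. borel))"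
    using Suc.prems by (auto intro!: measurable_component_singleton)
  have "(\<lambda>f. (chain step s f n, f (Inl n), f (Inr n))) \<in> measurable (PiM J (\<lambda>_. borel)) (S \<Otimes>\<^sub>M borel \<Otimes>\<^sub>M borel)"
    by measurable
  from measurable_compose[OF this step] show ?case by simp
qed

context drawdown_model begin

abbreviation wait_law :: "real measure" where
  "wait_law \<equiv> density lborel (exponential_density lam)"

lemma prob_space_wait_law: "prob_space wait_law"
  using P.prob_space_distr[of "gap 0" borel] by (simp add: distr_gap)

lemma chain_measurable:
  fixes s :: "real \<times> real"
  assumes step: "(\<lambda>(s, t, z). step s t z) \<in> borel_measurable (borel \<Otimes>\<^sub>M borel \<Otimes>\<^sub>M borel)"
  shows "(\<lambda>\<omega>. chain step s (\<lambda>i. shock i \<omega>) n) \<in> borel_measurable P"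
proof -
  have sb: "s \<in> space borel" by simp
  have "(\<lambda>\<omega>. \<lambda>i\<in>UNIV. shock i \<omega>) \<in> measurable P (PiM UNIV (\<lambda>_. borel))"
    using shock_indep by (intro measurable_restrict) (auto simp: P.indep_vars_def)
  from measurable_compose[OF this measurable_chain[OF step sb, of n UNIV]] show ?thesis by (simp add: restrict_UNIV)
qed

text \<open>The state after \<open>n\<close> steps is independent of the next pair of shocks, so
  Fubini allows the one-step inequality to be applied with the state held fixed. The invariant
  \<open>I\<close> confines that inequality to states that can occur. The factor \<open>q\<close> is
  1 for the value function and below 1 for the probability of being undecided.\<close>

lemma chain_expectation_step:
  fixes h :: "real \<times> real \<Rightarrow> real"
  assumes step: "(\<lambda>(s, t, z). step s t z) \<in> borel_measurable (borel \<Otimes>\<^sub>M borel \<Otimes>\<^sub>M borel)"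
    and h: "h \<in> borel_measurable borel" "\<And>s. \<bar>h s\<bar> \<le> B"
    and I: "I s" "\<And>s t z. I s \<Longrightarrow> I (step s t z)"
    and le: "\<And>s. I s \<Longrightarrow> (LINT w|(wait_law \<Otimes>\<^sub>M \<nu>). h (step s (fst w) (snd w))) \<le> q * h s"
  shows "P.expectation (\<lambda>\<omega>. h (chain step s (\<lambda>i. shock i \<omega>) (Suc n)))
     \<le> q * P.expectation (\<lambda>\<omega>. h (chain step s (\<lambda>i. shock i \<omega>) n))"
proof -
  have sb: "s \<in> space borel" by simp
  let ?X = "\<lambda>\<omega>. chain step s (\<lambda>i. shock i \<omega>) n"
  let ?W = "\<lambda>\<omega>. (shock (Inl n) \<omega>, shock (Inr n) \<omega>)"
  let ?Q = "wait_law \<Otimes>\<^sub>M \<nu>"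
  let ?J = "Inl ` {..<n} \<union> Inr ` {..<n} :: (nat + nat) set"
  note h(1) [measurable] step[unfolded split_beta, measurable]
  have X [measurable]: "?X \<in> borel_measurable P" by (rule chain_measurable[OF step])
  have shock [measurable]: "shock i \<in> borel_measurable P" for i
    using shock_indep by (auto simp: P.indep_vars_def)
  have single: "P.indep_var borel (shock (Inl n)) borel (shock (Inr n))"
  proof -
    have "P.indep_var borel ((\<lambda>f. f (Inl n)) \<circ> (\<lambda>\<omega>. restrict (\<lambda>i. shock i \<omega>) {Inl n}))
        borel ((\<lambda>f. f (Inr n)) \<circ> (\<lambda>\<omega>. restrict (\<lambda>i. shock i \<omega>) {Inr n}))"
      by (intro P.indep_var_compose[OF P.indep_var_restrict[OF shock_indep]] measurable_component_singleton) auto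
    then show ?thesis by (simp add: comp_def)
  qed
  then have W: "distr P (borel \<Otimes>\<^sub>M borel) ?W = ?Q"
    unfolding P.indep_var_distribution_eq using claim_sizes_law[of n] distr_gap[of n] by (simp add: shock_def)
  \<comment> \<open>\<open>?J\<close> consists of the indices below \<open>n\<close>, disjoint from
    the two indices of the next claim.\<close>
  have "P.indep_var borel ((\<lambda>f. chain step s f n) \<circ> (\<lambda>\<omega>. restrict (\<lambda>i. shock i \<omega>) ?J))
      (borel \<Otimes>\<^sub>M borel) ((\<lambda>f. (f (Inl n), f (Inr n))) \<circ> (\<lambda>\<omega>. restrict (\<lambda>i. shock i \<omega>) {Inl n, Inr n}))"
    by (intro P.indep_var_compose[OF P.indep_var_restrict[OF shock_indep]] measurable_chain[OF step sb]
        measurable_Pair measurable_component_singleton) auto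
  moreover have "(\<lambda>f. chain step s f n) \<circ> (\<lambda>\<omega>. restrict (\<lambda>i. shock i \<omega>) ?J) = ?X"
    by (auto simp: fun_eq_iff intro!: chain_cong)
  ultimately have "P.indep_var borel ?X (borel \<Otimes>\<^sub>M borel) ?W"
    by (simp add: comp_def)
  then have joint: "distr P borel ?X \<Otimes>\<^sub>M ?Q = distr P (borel \<Otimes>\<^sub>M borel \<Otimes>\<^sub>M borel) (\<lambda>\<omega>. (?X \<omega>, ?W \<omega>))"
    unfolding P.indep_var_distribution_eq W by simp
  interpret DX: prob_space "distr P borel ?X" by (rule P.prob_space_distr[OF X])
  interpret Q: prob_space ?Q unfolding W[symmetric] by (rule P.prob_space_distr) measurable
  interpret XQ: pair_prob_space "distr P borel ?X" ?Q ..
  let ?g = "\<lambda>(s, w). h (step s (fst w) (snd w))"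
  have sQ: "sets ?Q = sets (borel \<Otimes>\<^sub>M borel)" unfolding W[symmetric] by simp
  have g [measurable]: "?g \<in> borel_measurable (borel \<Otimes>\<^sub>M borel \<Otimes>\<^sub>M borel)"
    using measurable_compose[OF step h(1)] by (simp add: split_beta)
  have gQ: "?g \<in> borel_measurable (distr P borel ?X \<Otimes>\<^sub>M ?Q)"
    unfolding joint by simp
  have int: "integrable (distr P borel ?X \<Otimes>\<^sub>M ?Q) ?g"
    by (rule XQ.integrable_const_bound[of _ B, OF AE_I2 gQ]) (simp only: split_beta real_norm_def h(2))
  have "P.expectation (\<lambda>\<omega>. h (chain step s (\<lambda>i. shock i \<omega>) (Suc n))) = P.expectation (\<lambda>\<omega>. ?g (?X \<omega>, ?W \<omega>))"
    by simp
  also have "\<dots> = (LINT z|(distr P borel ?X \<Otimes>\<^sub>M ?Q). ?g z)"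
    unfolding joint by (subst integral_distr) (auto intro!: measurable_Pair)
  also have "\<dots> = (LINT s|(distr P borel ?X). LINT w|?Q. ?g (s, w))"
    using XQ.integral_fst'[OF int] by simp
  also have "\<dots> \<le> (LINT s|(distr P borel ?X). q * h s)"
  proof (rule integral_mono_AE)
    show "integrable (distr P borel ?X) (\<lambda>s. LINT w|?Q. ?g (s, w))" by (rule XQ.integrable_fst'[OF int])
    show "integrable (distr P borel ?X) (\<lambda>s. q * h s)"
      by (rule integrable_mult_right, rule DX.integrable_const_bound[of _ B]) (use h in auto)
    have "AE \<omega> in P. (LINT w|?Q. ?g (?X \<omega>, w)) \<le> q * h (?X \<omega>)"
      using AE_space by eventually_elim (use le measurable_space[OF X] chain_invariant[of I, OF I] in auto)
    moreover have "(\<lambda>s. LINT w|?Q. ?g (s, w)) \<in> borel_measurable borel"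
    proof -
      have "(\<lambda>s. LINT w|?Q. ?g (s, w)) \<in> borel_measurable (distr P borel ?X)"
        using XQ.integrable_fst'[OF int] by (rule borel_measurable_integrable)
      then show ?thesis by simp
    qed
    ultimately show "AE s in distr P borel ?X. (LINT w|?Q. ?g (s, w)) \<le> q * h s"
      using X by (subst AE_distr_iff) (auto intro!: borel_measurable_le)
  qed
  also have "\<dots> = q * P.expectation (\<lambda>\<omega>. h (?X \<omega>))"
    by (subst integral_distr) auto
  finally show ?thesis .
qed

end

subsection \<open>The static strategy\<close>

lemma closed_drawdown_domain: "closed (drawdown_domain \<alpha>)"
proof -
  have "drawdown_domain \<alpha> = {s. 0 \<le> fst s \<and> 0 \<le> snd s \<and> \<alpha> * snd s \<le> fst s \<and> fst s \<le> snd s}"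
    by (auto simp: drawdown_domain_def)
  also have "closed \<dots>" by (intro closed_Collect_conj closed_Collect_le continuous_intros)
  finally show ?thesis .
qed

lemma abs_le_one_plus_square: "\<bar>y\<bar> \<le> 1 + y\<^sup>2" for y :: real
proof -
  have "0 \<le> (\<bar>y\<bar> - 1)\<^sup>2" by simp
  then have "2 * \<bar>y\<bar> \<le> 1 + y\<^sup>2" by (simp add: power2_diff)
  then show ?thesis by (smt (verit) abs_ge_zero)
qed

section \<open>Moments of the claim size\<close>

context insurance_market begin

lemma AE_claim_pos: "AE y in \<nu>. 0 < y"
proof -
  have "prob {..0} = 0" using claim_pos by (simp add: cdf_def)
  then have "AE y in \<nu>. y \<notin> {..0}" by (subst (asm) prob_eq_0) auto
  then show ?thesis by eventually_elim auto
qed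

text \<open>The law is carried by the positive half line, so an integrand given only there may be
  exchanged for a Borel function on the whole line.\<close>

lemma claim_expect_eq:
  assumes g: "g \<in> borel_measurable borel" and eq: "\<And>y. 0 \<le> y \<Longrightarrow> f y = g y"
  shows "claim_expect \<nu> f = (LINT y|\<nu>. g y)"
proof -
  have "claim_expect \<nu> f = (LINT y|\<nu>. indicator {0..} y * g y)"
    unfolding claim_expect_def set_lebesgue_integral_def
    by (intro Bochner_Integration.integral_cong) (auto simp: indicator_def eq)
  also have "\<dots> = (LINT y|\<nu>. g y)"
  proof (rule integral_cong_AE)
    show "AE y in \<nu>. indicator {0..} y * g y = g y" using AE_claim_pos by eventually_elim auto
  qed (use g in auto)
  finally show ?thesis .
qed

text \<open>The moment generating function is finite at \<delta> / 2, and for positive arguments the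
  Taylor bound of the exponential dominates the square.\<close>

lemma integrable_claim_square: "integrable \<nu> (\<lambda>y. y\<^sup>2)"
proof -
  obtain \<delta> where \<delta>: "\<delta> > 0" "\<And>t. \<bar>t\<bar> < \<delta> \<Longrightarrow> integrable \<nu> (\<lambda>y. exp (t * y))"
    using claim_mgf by blast
  define t where "t = \<delta> / 2"
  have t: "t > 0" "integrable \<nu> (\<lambda>y. exp (t * y))" using \<delta>(1) \<delta>(2)[of t] by (auto simp: t_def)
  show ?thesis
  proof (rule Bochner_Integration.integrable_bound)
    show "integrable \<nu> (\<lambda>y. 2 / t\<^sup>2 * exp (t * y))" using t(2) by simp
    show "AE y in \<nu>. norm (y\<^sup>2) \<le> norm (2 / t\<^sup>2 * exp (t * y))"
      using AE_claim_pos
    proof eventually_elim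
      case (elim y)
      have "(t * y)\<^sup>2 / 2 \<le> exp (t * y)"
        using exp_lower_Taylor_quadratic[of "t * y"] mult_pos_pos[OF t(1) elim] by linarith
      then show ?case using t(1) by (simp add: field_simps power_mult_distrib)
    qed
  qed simp
qed

lemma integrable_dominated_by_claim_square:
  assumes "f \<in> borel_measurable borel" "\<And>y. \<bar>f y\<bar> \<le> 1 + y\<^sup>2"
  shows "integrable \<nu> f"
proof (rule Bochner_Integration.integrable_bound)
  show "integrable \<nu> (\<lambda>y. 1 + y\<^sup>2)" using integrable_claim_square by simp
  show "AE y in \<nu>. norm (f y) \<le> norm (1 + y\<^sup>2)"
    using assms(2) by (auto intro!: AE_I2 simp: abs_of_nonneg add_nonneg_nonneg)
qed (use assms in simp)

end

text \<open>The hypotheses of the theorem with a witness \<open>R\<close> of condition (iv) held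
  fixed. The limit of v along the diagonal stays outside; it enters only when the level tends to
  infinity.\<close>

locale static_verification = drawdown_model P F N Z \<nu> \<alpha> lam \<theta> \<eta> c
  for P :: "'a measure" and F :: "real \<Rightarrow> 'a measure"
    and N :: "real \<Rightarrow> 'a \<Rightarrow> nat" and Z :: "nat \<Rightarrow> 'a \<Rightarrow> real"
    and \<nu> :: "real measure" and \<alpha> lam \<theta> \<eta> c :: real +
  fixes v vx vm :: "real \<times> real \<Rightarrow> real" and R :: "real \<Rightarrow> real"
  assumes C11: "C11_on_domain \<alpha> v vx vm"
    and bounded_v: "bounded (v ` {(x, m). 0 \<le> m \<and> x \<le> m})"
    and v_below: "\<And>x m. 0 \<le> m \<Longrightarrow> x < \<alpha> * m \<Longrightarrow> v (x, m) = 1"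
    and vm_diagonal: "\<And>m. 0 \<le> m \<Longrightarrow> vm (m, m) \<le> 0"
    and R_admissible: "admissible_retention \<nu> lam \<theta> \<eta> c R"
    and generator_le: "\<And>x m. (x, m) \<in> drawdown_domain \<alpha> \<Longrightarrow> generator \<nu> lam \<theta> \<eta> c R v vx x m \<le> 0"
begin

definition p :: real where "p = net_premium \<nu> lam \<theta> \<eta> c R"

text \<open>A Borel function on the whole line, whereas \<open>R\<close> is controlled on the half
  line only.\<close>

definition r :: "real \<Rightarrow> real" where "r y = (if 0 \<le> y then R y else 0)"

text \<open>A bounded Borel stand-in for \<open>v\<close>, of which nothing is known where x > m or
  m < 0. The value 1 is the one that \<open>v\<close> takes below the domain.\<close>

definition u :: "real \<times> real \<Rightarrow> real" where
  "u s = (if s \<in> drawdown_domain \<alpha> then v s else 1)"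

lemma r_measurable [measurable]: "r \<in> borel_measurable borel"
proof -
  have "(\<lambda>y. indicator {0..} y *\<^sub>R R y) \<in> borel_measurable borel"
    using R_admissible by (subst borel_measurable_restrict_space_iff[symmetric]) (auto simp: admissible_retention_def)
  also have "(\<lambda>y. indicator {0..} y *\<^sub>R R y) = r" by (auto simp: fun_eq_iff r_def indicator_def)
  finally show ?thesis .
qed

lemma r_bounds: "0 \<le> r y" "0 \<le> y \<Longrightarrow> r y \<le> y"
  using R_admissible by (auto simp: r_def admissible_retention_def)

lemma r_abs_le: "\<bar>r y\<bar> \<le> \<bar>y\<bar>"
  using r_bounds[of y] by (auto simp: r_def)

lemma p_pos: "0 < p"
proof -
  have "claim_expect \<nu> R = (LINT y|\<nu>. r y)" by (rule market.claim_expect_eq[OF r_measurable]) (simp add: r_def)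
  then have "0 \<le> lam * claim_expect \<nu> R" using market.lambda_pos by (simp add: r_bounds(1))
  then show ?thesis using R_admissible by (simp add: p_def admissible_retention_def)
qed

text \<open>Expanding the square in the premium identifies the coefficient of \<open>vx\<close> in
  the generator as the income rate. The generator thus belongs to a surplus that rises at rate
  \<open>p\<close> between claims. The integrals can be split since every term is dominated by 1 + y
  * y.\<close>

lemma drift_eq:
  "p = - kappa \<nu> lam \<theta> \<eta> c + lam * ((1 + \<theta>) * claim_expect \<nu> R + \<eta> * claim_expect \<nu> (\<lambda>y. y * R y)
             - \<eta> / 2 * claim_expect \<nu> (\<lambda>y. (R y)\<^sup>2))"
proof -
  have i1: "integrable \<nu> (\<lambda>y. y)"
    by (rule market.integrable_dominated_by_claim_square) (auto intro: abs_le_one_plus_square)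
  have i2: "integrable \<nu> r"
    by (rule market.integrable_dominated_by_claim_square) (auto intro: order_trans[OF r_abs_le abs_le_one_plus_square])
  have i3: "integrable \<nu> (\<lambda>y. y * r y)"
  proof (rule market.integrable_dominated_by_claim_square)
    fix y :: real
    have "\<bar>y * r y\<bar> \<le> \<bar>y\<bar> * \<bar>y\<bar>" unfolding abs_mult by (intro mult_left_mono r_abs_le) auto
    then show "\<bar>y * r y\<bar> \<le> 1 + y\<^sup>2" by (simp add: power2_eq_square)
  qed simp
  have i4: "integrable \<nu> (\<lambda>y. (r y)\<^sup>2)"
  proof (rule market.integrable_dominated_by_claim_square)
    fix y :: real
    have "(r y)\<^sup>2 \<le> y\<^sup>2" using r_abs_le[of y] by (simp add: abs_le_square_iff)
    then show "\<bar>(r y)\<^sup>2\<bar> \<le> 1 + y\<^sup>2" by simp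
  qed simp
  note i5 = market.integrable_claim_square
  have e0: "claim_expect \<nu> (\<lambda>y. y) = (LINT y|\<nu>. y)"
    by (rule market.claim_expect_eq) auto
  have e1: "claim_expect \<nu> (\<lambda>y. y\<^sup>2) = (LINT y|\<nu>. y\<^sup>2)"
    by (rule market.claim_expect_eq) auto
  have e2: "claim_expect \<nu> R = (LINT y|\<nu>. r y)"
    by (rule market.claim_expect_eq, measurable, simp add: r_def)
  have e3: "claim_expect \<nu> (\<lambda>y. y * R y) = (LINT y|\<nu>. y * r y)"
    by (rule market.claim_expect_eq, measurable, simp add: r_def)
  have e4: "claim_expect \<nu> (\<lambda>y. (R y)\<^sup>2) = (LINT y|\<nu>. (r y)\<^sup>2)"
    by (rule market.claim_expect_eq, measurable, simp add: r_def)
  have e5: "claim_expect \<nu> (\<lambda>y. y - R y) = (LINT y|\<nu>. y - r y)"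
    by (rule market.claim_expect_eq, measurable, simp add: r_def)
  have e6: "claim_expect \<nu> (\<lambda>y. (y - R y)\<^sup>2) = (LINT y|\<nu>. y\<^sup>2 - 2 * (y * r y) + (r y)\<^sup>2)"
    by (rule market.claim_expect_eq, measurable, simp add: r_def power2_diff)
  have d1: "(LINT y|\<nu>. y - r y) = (LINT y|\<nu>. y) - (LINT y|\<nu>. r y)"
    using i1 i2 by simp
  have d2: "(LINT y|\<nu>. y\<^sup>2 - 2 * (y * r y) + (r y)\<^sup>2)
      = (LINT y|\<nu>. y\<^sup>2) - 2 * (LINT y|\<nu>. y * r y) + (LINT y|\<nu>. (r y)\<^sup>2)"
    using i3 i4 i5 by simp
  show ?thesis
    unfolding p_def net_premium_def kappa_def e0 e1 e2 e3 e4 e5 e6 d1 d2 by (simp add: field_simps)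
qed

lemma u_eq_v: "0 \<le> m \<Longrightarrow> x \<le> m \<Longrightarrow> u (x, m) = v (x, m)"
proof -
  assume m: "0 \<le> m" "x \<le> m"
  \<comment> \<open>Hence a negative \<open>x\<close> lies below \<alpha> * m, where
    \<open>u\<close> and \<open>v\<close> both equal 1.\<close>
  have "0 \<le> \<alpha> * m" using m market.alpha by simp
  then show ?thesis using m v_below[of m x] by (auto simp: u_def drawdown_domain_def)
qed

lemma u_measurable [measurable]: "u \<in> borel_measurable borel"
  unfolding u_def[abs_def] using C11 closed_drawdown_domain
  by (intro borel_measurable_continuous_on_if borel_closed) (auto simp: C11_on_domain_def)

lemma u_bounded: "\<exists>B. \<forall>s. \<bar>u s\<bar> \<le> B"
proof -
  obtain B where B: "\<forall>s\<in>{(x, m). 0 \<le> m \<and> x \<le> m}. norm (v s) \<le> B"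
    using bounded_v by (auto simp: bounded_iff)
  have "\<bar>u s\<bar> \<le> max B 1" for s
    using bspec[OF B, of s] by (auto simp: u_def drawdown_domain_def)
  then show ?thesis by blast
qed

lemma generator_drift:
  assumes xm: "(x, m) \<in> drawdown_domain \<alpha>"
  shows "p * vx (x, m) + lam * ((LINT y|\<nu>. u (x - r y, m)) - v (x, m)) \<le> 0"
proof -
  have "claim_expect \<nu> (\<lambda>y. v (x - R y, m)) = (LINT y|\<nu>. u (x - r y, m))"
  proof (rule market.claim_expect_eq)
    have "(\<lambda>y. (x - r y, m)) \<in> borel_measurable borel" unfolding borel_prod[symmetric] by measurable
    from measurable_compose[OF this u_measurable] show "(\<lambda>y. u (x - r y, m)) \<in> borel_measurable borel" .
    show "v (x - R y, m) = u (x - r y, m)" if "0 \<le> y" for y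
      using that xm r_bounds(1)[of y] by (subst u_eq_v) (auto simp: drawdown_domain_def r_def)
  qed
  then show ?thesis
    using generator_le[OF xm] unfolding generator_def drift_eq by (simp add: algebra_simps)
qed

section \<open>The chain stopped at drawdown or at level k\<close>

definition alive :: "real \<Rightarrow> real \<times> real \<Rightarrow> bool" where
  "alive k s \<longleftrightarrow> \<alpha> * snd s \<le> fst s \<and> fst s < k"

text \<open>The maximum is updated with the surplus just before the claim, since the claim itself
  can only lower the surplus.\<close>

definition free_step :: "real \<times> real \<Rightarrow> real \<Rightarrow> real \<Rightarrow> real \<times> real" where
  "free_step s t z = (fst s + p * t - r z, max (snd s) (fst s + p * t))"

text \<open>A state that is not alive is frozen. The pair (k, k) is not alive because
  \<open>alive\<close> demands a surplus strictly below \<open>k\<close>.\<close>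

definition stopped_step :: "real \<Rightarrow> real \<times> real \<Rightarrow> real \<Rightarrow> real \<Rightarrow> real \<times> real" where
  "stopped_step k s t z =
     (if alive k s then (if k \<le> fst s + p * t then (k, k) else free_step s t z) else s)"

text \<open>An invariant region that also contains the drawn-down states. As the maximum is at most
  \<open>k\<close>, a path that attains \<open>k\<close> does so in the state (k, k).\<close>

definition reachable :: "real \<Rightarrow> real \<times> real \<Rightarrow> bool" where
  "reachable k s \<longleftrightarrow> 0 \<le> snd s \<and> snd s \<le> k \<and> fst s \<le> snd s"

lemma reachable_step: "reachable k s \<Longrightarrow> reachable k (stopped_step k s t z)"
  using r_bounds(1)[of z] by (auto simp: reachable_def stopped_step_def free_step_def le_max_iff_disj)

lemma reachable_alive_domain: "reachable k s \<Longrightarrow> alive k s \<Longrightarrow> s \<in> drawdown_domain \<alpha>"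
  using mult_nonneg_nonneg[OF market.alpha(1), of "snd s"]
  by (auto simp: reachable_def alive_def drawdown_domain_def split_beta)

lemma stopped_step_measurable:
  "(\<lambda>(s, t, z). stopped_step k s t z) \<in> borel_measurable (borel \<Otimes>\<^sub>M borel \<Otimes>\<^sub>M borel)"
  unfolding borel_prod[symmetric] stopped_step_def free_step_def alive_def split_beta by measurable

lemma alive_measurable: "Measurable.pred borel (alive k)"
  unfolding borel_prod[symmetric] alive_def by measurable

text \<open>Let \<open>t1\<close> be the time needed to climb to \<open>k\<close>. With probability
  exp (- lam * t1) no claim comes earlier and the value is v(k, k); a claim at an earlier time
  \<open>t\<close> contributes \<open>G t\<close> under the exponential density.
  \<open>first_claim_inequality\<close> bounds the sum of the two.\<close>

lemma stopped_step_u: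
  assumes s: "reachable k s"
  shows "(LINT w|(wait_law \<Otimes>\<^sub>M \<nu>). u (stopped_step k s (fst w) (snd w))) \<le> u s"
proof -
  interpret W: prob_space wait_law by (rule prob_space_wait_law)
  interpret WN: pair_prob_space wait_law \<nu> ..
  obtain x m where xm: "s = (x, m)" by (cases s)
  show ?thesis
  proof (cases "alive k s")
    case False
    then show ?thesis by (simp add: stopped_step_def WN.prob_space)
  next
    case True
    have D: "(x, m) \<in> drawdown_domain \<alpha>" using reachable_alive_domain[OF s True] xm by simp
    have xk: "x < k" "m \<le> k" "0 \<le> m" "x \<le> m" using s True xm by (auto simp: reachable_def alive_def)
    obtain B where B: "\<And>s. \<bar>u s\<bar> \<le> B" using u_bounded by blast
    define G where "G t = (LINT z|\<nu>. u (free_step s t z))" for t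
    define t1 where "t1 = (k - x) / p"
    have t1: "0 < t1" "k \<le> x + p * t \<longleftrightarrow> t1 \<le> t" for t
      using xk p_pos by (auto simp: t1_def field_simps)
    have sm: "(\<lambda>(t, z). stopped_step k s t z) \<in> borel_measurable (borel \<Otimes>\<^sub>M borel)"
      using measurable_compose[OF _ stopped_step_measurable[of k], of "\<lambda>(t, z). (s, t, z)" "borel \<Otimes>\<^sub>M borel"]
      by (simp add: split_beta)
    have um: "(\<lambda>(t, z). u (stopped_step k s t z)) \<in> borel_measurable (wait_law \<Otimes>\<^sub>M \<nu>)"
      using measurable_compose[OF sm u_measurable] by (simp add: split_beta cong: measurable_cong_sets)
    have int: "integrable (wait_law \<Otimes>\<^sub>M \<nu>) (\<lambda>(t, z). u (stopped_step k s t z))"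
      by (rule WN.integrable_const_bound[of _ B, OF AE_I2 um]) (simp only: split_beta real_norm_def B)
    have fm: "(\<lambda>(t, z). u (free_step s t z)) \<in> borel_measurable (borel \<Otimes>\<^sub>M \<nu>)"
    proof -
      have "(\<lambda>(t, z). free_step s t z) \<in> borel_measurable (borel \<Otimes>\<^sub>M borel)"
        unfolding borel_prod[symmetric] free_step_def split_beta by measurable
      from measurable_compose[OF this u_measurable] show ?thesis
        by (simp add: split_beta cong: measurable_cong_sets)
    qed
    have G [measurable]: "G \<in> borel_measurable borel"
      unfolding G_def using fm by (intro market.borel_measurable_lebesgue_integral) (simp add: split_beta)
    have GB: "\<bar>G t\<bar> \<le> B" for t
    proof -
      have "\<bar>G t\<bar> \<le> (LINT z|\<nu>. \<bar>u (free_step s t z)\<bar>)" unfolding G_def by (rule integral_abs_bound)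
      also have "\<dots> \<le> (LINT z|\<nu>. B)"
      proof (rule integral_mono_AE')
        show "AE z in \<nu>. \<bar>u (free_step s t z)\<bar> \<le> B" using B by auto
      qed (use order_trans[OF abs_ge_zero B] in auto)
      finally show ?thesis using market.prob_space by simp
    qed
    have intG: "integrable wait_law (\<lambda>t. indicator {0..t1} t * G t)"
      by (rule W.integrable_const_bound[of _ B]) (use GB order_trans[OF abs_ge_zero GB] in \<open>auto simp: indicator_def\<close>)
    have dens: "exponential_density lam t * (indicator {0..t1} t * G t) = indicator {0..t1} t *\<^sub>R (lam * exp (- lam * t) * G t)" for t
      by (auto simp: indicator_def exponential_density_def mult_ac)
    have "(LINT w|(wait_law \<Otimes>\<^sub>M \<nu>). u (stopped_step k s (fst w) (snd w)))
        = (LINT t|wait_law. LINT z|\<nu>. u (stopped_step k s t z))"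
      using WN.integral_fst'[OF int] by (simp add: case_prod_unfold)
    also have "\<dots> = (LINT t|wait_law. indicator {t1<..} t * v (k, k) + indicator {0..t1} t * G t)"
    proof (rule integral_cong_AE)
      show "(\<lambda>t. LINT z|\<nu>. u (stopped_step k s t z)) \<in> borel_measurable wait_law"
        using WN.integrable_fst'[OF int] by (simp add: split_beta borel_measurable_integrable)
      \<comment> \<open>At \<open>t = t1\<close> the step already stops at level \<open>k\<close>
        while the split integrand still counts \<open>G\<close>; this single time is a null
        set.\<close>
      have "AE t in wait_law. 0 \<le> t \<and> t \<noteq> t1"
        using AE_lborel_singleton[of t1]
        by (subst AE_density) (auto simp: exponential_density_def elim!: eventually_mono)
      then show "AE t in wait_law. (LINT z|\<nu>. u (stopped_step k s t z)) = indicator {t1<..} t * v (k, k) + indicator {0..t1} t * G t"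
      proof eventually_elim
        case (elim t)
        have "stopped_step k s t z = (if t1 \<le> t then (k, k) else free_step s t z)" for z
          using True xm t1(2)[of t] by (simp add: stopped_step_def)
        moreover have "market.prob UNIV = 1" using market.prob_space by simp
        ultimately show ?case using elim xk u_eq_v[of k k]
          by (auto simp: G_def[symmetric] indicator_def)
      qed
    qed simp
    also have "\<dots> = (LINT t|wait_law. indicator {t1<..} t * v (k, k)) + (LINT t|wait_law. indicator {0..t1} t * G t)"
      by (rule Bochner_Integration.integral_add[OF _ intG]) (auto intro!: integrable_mult_left integrable_real_indicator simp: W.emeasure_eq_measure)
    also have "(LINT t|wait_law. indicator {t1<..} t * v (k, k)) = exp (- lam * t1) * v (k, k)"
    proof -
      have "measure (distr P borel (gap 0)) {t1<..} = P.prob {\<omega>\<in>space P. t1 < gap 0 \<omega>}"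
        by (subst measure_distr) (auto intro!: arg_cong[where f=P.prob])
      then have "measure wait_law {t1<..} = exp (- lam * t1)"
        using gap_survival[of t1 0] t1(1) by (simp add: distr_gap)
      then show ?thesis by simp
    qed
    also have "(LINT t|wait_law. indicator {0..t1} t * G t) = (LINT t:{0..t1}|lborel. lam * exp (- lam * t) * G t)"
      unfolding set_lebesgue_integral_def dens[symmetric]
      by (subst integral_density) (auto intro!: exponential_density_nonneg market.lambda_pos)
    also have "\<dots> \<le> v (x, m) - exp (- lam * t1) * v (k, k)"
    proof (rule first_claim_inequality[OF C11 market.alpha p_pos market.lambda_pos vm_diagonal D xk(1,2) t1_def])
      fix t assume t: "0 \<le> t" "t \<le> t1"
      have "(x + p * t, max m (x + p * t)) \<in> drawdown_domain \<alpha>"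
        using p_pos t by (intro drawdown_domain_ascend[OF market.alpha D]) auto
      from generator_drift[OF this]
      show "p * vx (x + p * t, max m (x + p * t)) + lam * (G t - v (x + p * t, max m (x + p * t))) \<le> 0"
        by (simp add: G_def free_step_def xm)
    next
      have "integrable lborel (\<lambda>t. exponential_density lam t * (indicator {0..t1} t * G t))"
        using intG by (subst (asm) integrable_density) (auto intro!: exponential_density_nonneg market.lambda_pos)
      then show "set_integrable lborel {0..t1} (\<lambda>t. lam * exp (- lam * t) * G t)"
        unfolding set_integrable_def dens .
    qed
    finally show ?thesis using D xm by (simp add: u_def)
  qed
qed

text \<open>An alive state has nonnegative surplus, so it stays alive only if the waiting time is at
  most k / p. The resulting bound does not depend on the state, which makes the decay
  geometric.\<close>

lemma stopped_step_alive:
  assumes s: "reachable k s" and k: "0 < k"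
  shows "(LINT w|(wait_law \<Otimes>\<^sub>M \<nu>). indicat_real (Collect (alive k)) (stopped_step k s (fst w) (snd w)))
    \<le> (1 - exp (- lam * (k / p))) * indicator (Collect (alive k)) s"
proof (cases "alive k s")
  case False
  then show ?thesis by (simp add: stopped_step_def)
next
  case True
  interpret W: prob_space wait_law by (rule prob_space_wait_law)
  interpret WN: pair_prob_space wait_law \<nu> ..
  have s0: "0 \<le> fst s" using reachable_alive_domain[OF s True] by (auto simp: drawdown_domain_def)
  have kp: "0 < k / p" using k p_pos by simp
  have "(LINT w|(wait_law \<Otimes>\<^sub>M \<nu>). indicat_real (Collect (alive k)) (stopped_step k s (fst w) (snd w)))
      \<le> (LINT w|(wait_law \<Otimes>\<^sub>M \<nu>). indicator ({..k / p} \<times> UNIV) w)"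
  proof (rule integral_mono_AE')
    show "integrable (wait_law \<Otimes>\<^sub>M \<nu>) (indicat_real ({..k / p} \<times> UNIV))"
      by (rule integrable_real_indicator) (auto simp: WN.emeasure_eq_measure)
    show "AE w in wait_law \<Otimes>\<^sub>M \<nu>. indicat_real (Collect (alive k)) (stopped_step k s (fst w) (snd w)) \<le> indicator ({..k / p} \<times> UNIV) w"
    proof (intro AE_I2)
      fix w :: "real \<times> real"
      have "alive k (stopped_step k s (fst w) (snd w)) \<Longrightarrow> fst w \<le> k / p"
      proof -
        assume a: "alive k (stopped_step k s (fst w) (snd w))"
        have "\<not> alive k (k, k)" by (simp add: alive_def)
        then have "fst s + p * fst w < k" using a True by (auto simp: stopped_step_def split: if_splits)
        then have "p * fst w \<le> k" using s0 by simp
        then show ?thesis using p_pos by (simp add: field_simps)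
      qed
      then show "indicat_real (Collect (alive k)) (stopped_step k s (fst w) (snd w)) \<le> indicator ({..k / p} \<times> UNIV) w"
        by (cases w) (auto simp: indicator_def)
    qed
  qed simp
  also have "\<dots> = measure (wait_law \<Otimes>\<^sub>M \<nu>) ({..k / p} \<times> UNIV)" by (simp add: space_pair_measure)
  also have "\<dots> = measure wait_law {..k / p} * measure \<nu> UNIV"
    unfolding measure_def by (subst market.emeasure_pair_measure_Times) (auto simp: enn2real_mult)
  also have "measure \<nu> UNIV = 1" using market.prob_space by simp
  also have "measure wait_law {..k / p} = 1 - exp (- lam * (k / p))"
  proof -
    have "measure (distr P borel (gap 0)) {..k / p} = P.prob (space P - {\<omega>\<in>space P. k / p < gap 0 \<omega>})"
      by (subst measure_distr) (auto intro!: arg_cong[where f=P.prob])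
    also have "\<dots> = 1 - exp (- lam * (k / p))"
      using kp by (subst P.prob_compl) (auto simp: gap_survival)
    finally show ?thesis by (simp add: distr_gap)
  qed
  finally show ?thesis using True by simp
qed

section \<open>Drawdown before level k, and the limit of large levels\<close>

abbreviation stopped_chain :: "real \<Rightarrow> real \<times> real \<Rightarrow> nat \<Rightarrow> 'a \<Rightarrow> real \<times> real" where
  "stopped_chain k s n \<omega> \<equiv> chain (stopped_step k) s (\<lambda>i. shock i \<omega>) n"

definition drawn_down :: "real \<times> real \<Rightarrow> bool" where
  "drawn_down s \<longleftrightarrow> fst s < \<alpha> * snd s"

lemma drawn_down_measurable: "Measurable.pred borel drawn_down"
  unfolding borel_prod[symmetric] drawn_down_def by measurable

lemma stopped_chain_measurable [measurable]: "stopped_chain k s n \<in> borel_measurable P"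
  by (rule chain_measurable[OF stopped_step_measurable])

lemma drawn_down_event [measurable]: "{\<omega>\<in>space P. drawn_down (stopped_chain k s n \<omega>)} \<in> P.events"
  using measurable_compose[OF stopped_chain_measurable drawn_down_measurable] by (simp add: pred_def)

text \<open>The indicator of drawdown is dominated pointwise by \<open>u\<close>, plus the charge at
  (k, k), plus \<open>B\<close> on the undecided states. Taking expectations turns the first term
  into at most \<open>u s\<close> and the last into the geometric term.\<close>

lemma stopped_chain_drawdown_prob:
  assumes s: "reachable k s" and k: "0 < k" and B: "\<And>s. \<bar>u s\<bar> \<le> B"
  shows "P.prob {\<omega>\<in>space P. drawn_down (stopped_chain k s n \<omega>)}
    \<le> u s + max 0 (- v (k, k)) + B * (1 - exp (- lam * (k / p))) ^ n"
proof -
  let ?q = "1 - exp (- lam * (k / p))"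
  let ?e = "max 0 (- v (k, k))"
  let ?a = "indicat_real (Collect (alive k))"
  have q: "0 \<le> ?q" using market.lambda_pos k p_pos by simp
  have B0: "0 \<le> B" by (rule order_trans[OF abs_ge_zero B])
  have am: "?a \<in> borel_measurable borel"
    using alive_measurable by (intro borel_measurable_indicator) (simp add: pred_def)
  have Eu: "P.expectation (\<lambda>\<omega>. u (stopped_chain k s n \<omega>)) \<le> u s" for n
  proof (induction n)
    case 0
    show ?case by (simp add: P.prob_space)
  next
    case (Suc n)
    have "P.expectation (\<lambda>\<omega>. u (stopped_chain k s (Suc n) \<omega>)) \<le> 1 * P.expectation (\<lambda>\<omega>. u (stopped_chain k s n \<omega>))"
    proof (rule chain_expectation_step[where I="reachable k" and B=B, OF stopped_step_measurable u_measurable B s])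
      show "reachable k (stopped_step k s t z)" if "reachable k s" for s t z
        by (rule reachable_step[OF that])
      show "(LINT w|(wait_law \<Otimes>\<^sub>M \<nu>). u (stopped_step k s (fst w) (snd w))) \<le> 1 * u s" if "reachable k s" for s
        using stopped_step_u[OF that] by simp
    qed
    then show ?case using Suc by simp
  qed
  have Ea: "P.expectation (\<lambda>\<omega>. ?a (stopped_chain k s n \<omega>)) \<le> ?q ^ n" for n
  proof (induction n)
    case 0
    show ?case by (simp add: P.prob_space indicator_def)
  next
    case (Suc n)
    have "P.expectation (\<lambda>\<omega>. ?a (stopped_chain k s (Suc n) \<omega>)) \<le> ?q * P.expectation (\<lambda>\<omega>. ?a (stopped_chain k s n \<omega>))"
    proof (rule chain_expectation_step[where I="reachable k" and B=1, OF stopped_step_measurable am _ s])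
      show "\<bar>?a s\<bar> \<le> 1" for s by (simp add: indicator_def)
      show "reachable k (stopped_step k s t z)" if "reachable k s" for s t z
        by (rule reachable_step[OF that])
      show "(LINT w|(wait_law \<Otimes>\<^sub>M \<nu>). ?a (stopped_step k s (fst w) (snd w))) \<le> ?q * ?a s" if "reachable k s" for s
        by (rule stopped_step_alive[OF that k])
    qed
    also have "\<dots> \<le> ?q * ?q ^ n" using Suc q by (rule mult_left_mono)
    finally show ?case by simp
  qed
  have pw: "indicat_real (Collect drawn_down) s' \<le> u s' + ?e + B * ?a s'" if s': "reachable k s'" for s'
  proof -
    \<comment> \<open>Drawn-down states have \<open>u s' = 1\<close>, alive states have
      \<open>u s' \<ge> - B\<close>, and any other reachable state is (k, k), where the charge makes
      up for a negative value.\<close>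
    consider "drawn_down s'" | "\<not> drawn_down s'" "alive k s'" | "s' = (k, k)" "\<not> drawn_down s'"
      using s' by (cases s') (fastforce simp: drawn_down_def alive_def reachable_def)
    then show ?thesis
    proof cases
      case 1
      then have "u s' = 1" "?a s' = 0" by (auto simp: u_def drawn_down_def drawdown_domain_def alive_def indicator_def)
      then show ?thesis by (simp add: indicator_def)
    next
      case 2
      then show ?thesis using B[of s'] by (simp add: indicator_def)
    next
      case 3
      then show ?thesis using u_eq_v[of k k] k B0 by (auto simp: indicator_def)
    qed
  qed
  have um: "(\<lambda>\<omega>. u (stopped_chain k s n \<omega>)) \<in> borel_measurable P" by measurable
  have aem: "(\<lambda>\<omega>. ?a (stopped_chain k s n \<omega>)) \<in> borel_measurable P"
    by (rule measurable_compose[OF stopped_chain_measurable am])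
  have iu: "integrable P (\<lambda>\<omega>. u (stopped_chain k s n \<omega>))"
    by (rule P.integrable_const_bound[of _ B, OF AE_I2 um]) (use B in auto)
  have ia: "integrable P (\<lambda>\<omega>. ?a (stopped_chain k s n \<omega>))"
    by (rule P.integrable_const_bound[of _ 1, OF AE_I2 aem]) (auto simp: indicator_def)
  have "P.prob {\<omega>\<in>space P. drawn_down (stopped_chain k s n \<omega>)}
      = P.expectation (indicator {\<omega>\<in>space P. drawn_down (stopped_chain k s n \<omega>)})" by simp
  also have "\<dots> \<le> P.expectation (\<lambda>\<omega>. u (stopped_chain k s n \<omega>) + ?e + B * ?a (stopped_chain k s n \<omega>))"
  proof (rule integral_mono)
    fix \<omega> assume "\<omega> \<in> space P"
    have "reachable k (stopped_chain k s n \<omega>)" by (rule chain_invariant[where I="reachable k", OF s reachable_step])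
    from pw[OF this] \<open>\<omega> \<in> space P\<close>
    show "indicator {\<omega>\<in>space P. drawn_down (stopped_chain k s n \<omega>)} \<omega> \<le> u (stopped_chain k s n \<omega>) + ?e + B * ?a (stopped_chain k s n \<omega>)"
      by (simp add: indicator_def)
  qed (use iu ia in \<open>auto intro!: integrable_real_indicator simp: P.emeasure_eq_measure\<close>)
  also have "\<dots> = P.expectation (\<lambda>\<omega>. u (stopped_chain k s n \<omega>)) + ?e + B * P.expectation (\<lambda>\<omega>. ?a (stopped_chain k s n \<omega>))"
    using iu ia by (simp add: P.prob_space)
  also have "\<dots> \<le> u s + ?e + B * ?q ^ n"
    using Eu[of n] mult_left_mono[OF Ea[of n] B0] by linarith
  finally show ?thesis .
qed

text \<open>Drawn-down states are frozen, so the events increase with the number of steps while the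
  geometric term vanishes.\<close>

lemma stopped_drawdown_prob:
  assumes s: "reachable k s" and k: "0 < k"
  shows "P.prob (\<Union>n. {\<omega>\<in>space P. drawn_down (stopped_chain k s n \<omega>)}) \<le> u s + max 0 (- v (k, k))"
proof -
  obtain B where B: "\<And>s. \<bar>u s\<bar> \<le> B" using u_bounded by blast
  let ?D = "\<lambda>n. {\<omega>\<in>space P. drawn_down (stopped_chain k s n \<omega>)}"
  have "incseq ?D"
    by (rule incseq_SucI) (auto simp: stopped_step_def alive_def drawn_down_def)
  then have l1: "(\<lambda>n. P.prob (?D n)) \<longlonglongrightarrow> P.prob (\<Union>n. ?D n)"
    by (intro P.finite_Lim_measure_incseq) auto
  have "exp (- lam * (k / p)) \<le> 1" using market.lambda_pos k p_pos by simp
  then have "norm (1 - exp (- lam * (k / p))) < 1" by (simp add: abs_if)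
  then have l2: "(\<lambda>n. u s + max 0 (- v (k, k)) + B * (1 - exp (- lam * (k / p))) ^ n) \<longlonglongrightarrow> u s + max 0 (- v (k, k)) + B * 0"
    by (intro tendsto_add tendsto_mult tendsto_const LIMSEQ_power_zero)
  have "P.prob (\<Union>n. ?D n) \<le> u s + max 0 (- v (k, k)) + B * 0"
    by (rule LIMSEQ_le[OF l1 l2]) (intro exI allI impI stopped_chain_drawdown_prob[OF s k B])
  then show ?thesis by simp
qed

text \<open>Requiring drawdown of the stopped chains for all \<open>k \<ge> K\<close> makes the events increase with
  \<open>K\<close>.\<close>

definition drawdown_cover :: "real \<times> real \<Rightarrow> nat \<Rightarrow> 'a set" where
  "drawdown_cover s K = (\<Inter>k\<in>{K..}. \<Union>n. {\<omega>\<in>space P. drawn_down (stopped_chain (real k) s n \<omega>)})"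

lemma drawdown_cover_event [measurable]: "drawdown_cover s K \<in> P.events"
  unfolding drawdown_cover_def by (intro sets.countable_INT' sets.countable_UN) auto

text \<open>The cover for \<open>K\<close> is contained in the drawdown event of every level k >= K,
  so all the corresponding bounds hold for it. Letting k grow turns the charge into max 0 (- L) =
  0.\<close>

lemma drawdown_cover_prob:
  assumes xm: "(x, m) \<in> drawdown_domain \<alpha>"
    and L: "((\<lambda>m. v (m, m)) \<longlongrightarrow> L) at_top" "0 \<le> L"
  shows "P.prob (\<Union>K. drawdown_cover (x, m) K) \<le> v (x, m)"
proof -
  have each: "P.prob (drawdown_cover (x, m) K) \<le> v (x, m)" for K
  proof -
    have "(\<lambda>k. v (real k, real k)) \<longlonglongrightarrow> L"
      by (rule filterlim_compose[OF L(1) filterlim_real_sequentially])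
    then have "(\<lambda>k. v (x, m) + max 0 (- v (real k, real k))) \<longlonglongrightarrow> v (x, m) + max 0 (- L)"
      by (intro tendsto_add tendsto_max tendsto_minus tendsto_const)
    \<comment> \<open>The threshold on \<open>k\<close> ensures a positive level of at least
      \<open>m\<close> and \<open>K\<close>, so that the starting state is reachable.\<close>
    moreover have "P.prob (drawdown_cover (x, m) K) \<le> v (x, m) + max 0 (- v (real k, real k))"
      if k: "K + nat \<lceil>m\<rceil> + 1 \<le> k" for k
    proof -
      have "m \<le> real k" "0 < real k" "K \<le> k" using k by linarith+
      then have reach: "reachable (real k) (x, m)" using xm by (auto simp: reachable_def drawdown_domain_def)
      have "P.prob (drawdown_cover (x, m) K) \<le> P.prob (\<Union>n. {\<omega>\<in>space P. drawn_down (stopped_chain (real k) (x, m) n \<omega>)})"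
        using \<open>K \<le> k\<close> by (intro P.finite_measure_mono sets.countable_UN) (auto simp: drawdown_cover_def)
      also have "\<dots> \<le> u (x, m) + max 0 (- v (real k, real k))"
        by (rule stopped_drawdown_prob[OF reach \<open>0 < real k\<close>])
      finally show ?thesis using xm by (simp add: u_def)
    qed
    ultimately have "P.prob (drawdown_cover (x, m) K) \<le> v (x, m) + max 0 (- L)"
      by (intro LIMSEQ_le_const[of "\<lambda>k. v (x, m) + max 0 (- v (real k, real k))"]) auto
    then show ?thesis using L(2) by simp
  qed
  have "incseq (drawdown_cover (x, m))"
    by (rule incseq_SucI) (auto simp: drawdown_cover_def)
  then have "(\<lambda>K. P.prob (drawdown_cover (x, m) K)) \<longlonglongrightarrow> P.prob (\<Union>K. drawdown_cover (x, m) K)"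
    by (intro P.finite_Lim_measure_incseq) auto
  then show ?thesis by (rule LIMSEQ_le_const2) (use each in auto)
qed

section \<open>From the surplus in continuous time to the chain\<close>

text \<open>A static strategy ignores the time at which a claim arrives, so \<open>jump_time\<close>
  drops out of the sum.\<close>

lemma surplus_eq:
  assumes "\<And>n. 0 \<le> Z n \<omega>" "0 \<le> t"
  shows "surplus N Z \<nu> lam \<theta> \<eta> c (\<lambda>_ _. R) x t \<omega> = x + p * t - (\<Sum>i<N t \<omega>. r (Z i \<omega>))"
proof -
  have "(LINT s:{0..t}|lborel. p) = p * t"
    using assms(2) unfolding set_lebesgue_integral_def by (simp add: mult.commute)
  then show ?thesis using assms(1) unfolding surplus_def by (simp add: p_def r_def)
qed

text \<open>The surplus rises between claims, so drawdown can only begin at a claim and is seen by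
  the free chain \<open>C\<close>. Up to its first drawdown the free chain agrees with every stopped
  chain whose level exceeds the running maximum attained so far.\<close>

lemma drawdown_in_cover:
  assumes f: "counting_path (\<lambda>t. N t \<omega>)" and Z: "\<And>n. 0 \<le> Z n \<omega>" and sp: "\<omega> \<in> space P"
    and xm: "(x, m) \<in> drawdown_domain \<alpha>"
    and dd: "drawdown_time \<alpha> (surplus N Z \<nu> lam \<theta> \<eta> c (\<lambda>_ _. R) x) m \<omega> < \<infinity>"
  shows "\<omega> \<in> (\<Union>K. drawdown_cover (x, m) K)"
proof -
  define X where "X t = surplus N Z \<nu> lam \<theta> \<eta> c (\<lambda>_ _. R) x t \<omega>" for t
  define T where "T = arrival (\<lambda>t. N t \<omega>)"
  define C where "C = chain free_step (x, m) (\<lambda>i. shock i \<omega>)"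
  have X: "X t = x + p * t - (\<Sum>i<N t \<omega>. r (Z i \<omega>))" if "0 \<le> t" for t
    unfolding X_def by (rule surplus_eq[OF Z that])
  have T: "n \<le> N t \<omega> \<longleftrightarrow> T n \<le> t" if "0 \<le> t" for n t
    unfolding T_def by (rule counting_path_arrival(2)[OF f that])
  have gap: "gap n \<omega> = T (Suc n) - T n" for n by (simp add: T_def arrival_gap_def)
  have gap0: "0 \<le> gap n \<omega>" for n using counting_path_arrival_mono[OF f, of n "Suc n"] by (simp add: arrival_gap_def)
  have C_Suc: "fst (C (Suc n)) = fst (C n) + p * gap n \<omega> - r (Z n \<omega>)"
    "snd (C (Suc n)) = max (snd (C n)) (fst (C n) + p * gap n \<omega>)" for n
    by (simp_all add: C_def free_step_def shock_def)
  have fstC: "fst (C n) = x + p * T n - (\<Sum>i<n. r (Z i \<omega>))" for n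
  proof (induction n)
    case 0
    show ?case using counting_path_arrival_0[OF f] by (simp add: C_def T_def)
  next
    case (Suc n)
    then show ?case by (simp add: C_Suc(1) gap algebra_simps)
  qed
  have sndC: "snd (C i) \<le> snd (C j)" if "i \<le> j" for i j
    using that by (induction rule: dec_induct) (auto simp: C_Suc(2))
  have sndm: "m \<le> snd (C n)" for n using sndC[of 0 n] by (simp add: C_def)
  have fst_snd: "fst (C n) \<le> snd (C n)" for n
  proof (cases n)
    case 0
    then show ?thesis using xm by (simp add: C_def drawdown_domain_def)
  next
    case (Suc j)
    then show ?thesis using r_bounds(1)[of "Z j \<omega>"] C_Suc[of j] by simp
  qed
  obtain t where t: "0 \<le> t" "X t < \<alpha> * running_max (\<lambda>t _. X t) m t \<omega>"
  proof -
    \<comment> \<open>The infimum of the empty set is infinite, so a finite drawdown time provides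
      an actual time of drawdown.\<close>
    have "{t. 0 \<le> t \<and> surplus N Z \<nu> lam \<theta> \<eta> c (\<lambda>_ _. R) x t \<omega>
        < \<alpha> * running_max (surplus N Z \<nu> lam \<theta> \<eta> c (\<lambda>_ _. R) x) m t \<omega>} \<noteq> {}"
    proof
      assume e: "{t. 0 \<le> t \<and> surplus N Z \<nu> lam \<theta> \<eta> c (\<lambda>_ _. R) x t \<omega>
        < \<alpha> * running_max (surplus N Z \<nu> lam \<theta> \<eta> c (\<lambda>_ _. R) x) m t \<omega>} = {}"
      show False using dd unfolding drawdown_time_def e by (simp add: top_ereal_def)
    qed
    then show ?thesis using that by (auto simp: X_def running_max_def)
  qed
  have "\<exists>j. drawn_down (C j)"
  proof (rule ccontr)
    assume "\<not> (\<exists>j. drawn_down (C j))"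
    then have ok: "\<alpha> * snd (C j) \<le> fst (C j)" for j by (auto simp: drawn_down_def not_less)
    define n where "n = N t \<omega>"
    have Xn: "X t = fst (C n) + p * (t - T n)" using X[OF t(1)] fstC[of n] by (simp add: n_def algebra_simps)
    have Tn: "T n \<le> t" using T[OF t(1), of n] by (simp add: n_def)
    have Xge: "fst (C n) \<le> X t" using Xn Tn p_pos by simp
    \<comment> \<open>Before the last claim up to \<open>t\<close>, the surplus is bounded by its
      value just ahead of the next claim, which the chain records in its maximum; after that claim
      it is bounded by its value at \<open>t\<close>.\<close>
    have bound: "X s \<le> max (snd (C n)) (X t)" if s: "0 \<le> s" "s \<le> t" for s
    proof -
      define j where "j = N s \<omega>"
      have jn: "j \<le> n" using f s by (auto simp: counting_path_def mono_on_def j_def n_def)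
      have Xs: "X s = fst (C j) + p * (s - T j)" using X[OF s(1)] fstC[of j] by (simp add: j_def algebra_simps)
      show ?thesis
      proof (cases "j = n")
        case True
        then have "X s \<le> X t" using Xs Xn s p_pos by simp
        then show ?thesis by simp
      next
        case False
        have "s < T (Suc j)" using T[OF s(1), of "Suc j"] by (auto simp: j_def)
        then have "p * (s - T j) \<le> p * gap j \<omega>" using p_pos by (simp add: gap)
        then have "X s \<le> snd (C (Suc j))" using Xs by (simp add: C_Suc(2) le_max_iff_disj)
        also have "\<dots> \<le> snd (C n)" using jn False by (intro sndC) auto
        finally show ?thesis by simp
      qed
    qed
    have "(SUP s\<in>{0..t}. X s) \<le> max (snd (C n)) (X t)" using t(1) bound by (intro cSUP_least) auto
    then have rm: "running_max (\<lambda>t _. X t) m t \<omega> \<le> max (snd (C n)) (X t)"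
      unfolding running_max_def using sndm[of n] by (intro max.boundedI) (auto intro: max.coboundedI1)
    \<comment> \<open>Nonnegativity of the surplus at \<open>t\<close> is what turns \<alpha> < 1
      into \<alpha> * X t <= X t, needed when \<open>X t\<close> is itself the maximum.\<close>
    have "0 \<le> snd (C n)" using sndm[of n] xm by (auto simp: drawdown_domain_def)
    then have "0 \<le> X t" using ok[of n] Xge market.alpha mult_nonneg_nonneg[of \<alpha> "snd (C n)"] by linarith
    then have "\<alpha> * X t \<le> X t" using market.alpha mult_right_mono[of \<alpha> 1 "X t"] by simp
    moreover have "\<alpha> * snd (C n) \<le> X t" using ok[of n] Xge by linarith
    ultimately have "\<alpha> * max (snd (C n)) (X t) \<le> X t" by (simp add: max_def)
    then show False using t(2) mult_left_mono[OF rm market.alpha(1)] by linarith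
  qed
  \<comment> \<open>Taking the least such index keeps all earlier states alive, so the stopped
    chains are not frozen too soon.\<close>
  then obtain j where j: "drawn_down (C j)" "\<And>i. i < j \<Longrightarrow> \<not> drawn_down (C i)"
    using LeastI_ex[of "\<lambda>j. drawn_down (C j)"] not_less_Least[of _ "\<lambda>j. drawn_down (C j)"] by blast
  have same: "stopped_chain k (x, m) i \<omega> = C i" if k: "snd (C j) < k" and "i \<le> j" for k i
    using that(2)
  proof (induction i)
    case 0
    show ?case by (simp add: C_def)
  next
    case (Suc i)
    have "fst (C i) < k" using fst_snd[of i] sndC[of i j] Suc.prems k by simp
    then have "alive k (C i)" using j(2)[of i] Suc.prems by (simp add: alive_def drawn_down_def)
    moreover have "fst (C i) + p * gap i \<omega> \<le> snd (C j)"
      using sndC[of "Suc i" j] Suc.prems by (simp add: C_Suc(2))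
    then have "\<not> k \<le> fst (C i) + p * gap i \<omega>" using k by simp
    ultimately have "stopped_step k (C i) (shock (Inl i) \<omega>) (shock (Inr i) \<omega>) = C (Suc i)"
      by (simp add: stopped_step_def C_def shock_def)
    then show ?case using Suc by simp
  qed
  obtain K :: nat where K: "snd (C j) < real K" using reals_Archimedean2 by blast
  have "\<omega> \<in> drawdown_cover (x, m) K"
    unfolding drawdown_cover_def
  proof (intro INT_I UN_I)
    fix k assume "k \<in> {K..}"
    then have "snd (C j) < real k" using K by auto
    then show "\<omega> \<in> {\<omega>\<in>space P. drawn_down (stopped_chain (real k) (x, m) j \<omega>)}"
      using same[of "real k" j] j(1) sp by simp
  qed simp
  then show ?thesis by blast
qed

lemma static_strategy_admissible: "admissible_strategy P F \<nu> lam \<theta> \<eta> c (\<lambda>_ _. R)"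
proof -
  have R: "R \<in> borel_measurable (restrict_space borel {0..})"
    using R_admissible by (simp add: admissible_retention_def)
  have "(\<lambda>(\<omega>, y). R y) \<in> borel_measurable (M \<Otimes>\<^sub>M restrict_space borel {0..})" for M :: "'b measure"
    using measurable_compose[OF measurable_snd R] by (simp add: case_prod_unfold)
  moreover have "(\<lambda>(s, \<omega>, y). R y) \<in> borel_measurable (M \<Otimes>\<^sub>M M' \<Otimes>\<^sub>M restrict_space borel {0..})"
    for M :: "real measure" and M' :: "'a measure"
    using measurable_compose[OF measurable_snd measurable_compose[OF measurable_snd R]] by (simp add: case_prod_unfold)
  moreover have "\<forall>y\<ge>0. 0 \<le> R y \<and> R y \<le> y" "net_premium \<nu> lam \<theta> \<eta> c R > lam * claim_expect \<nu> R"
    using R_admissible by (simp_all add: admissible_retention_def)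
  ultimately show ?thesis
    unfolding admissible_strategy_def by (intro conjI allI impI ballI AE_I2) blast+
qed

lemma claims_nonneg: "AE \<omega> in P. \<forall>n. 0 \<le> Z n \<omega>"
proof (subst AE_all_countable, intro allI)
  fix n
  have "AE y in distr P borel (Z n). 0 < y" unfolding claim_sizes_law by (rule market.AE_claim_pos)
  then have "AE \<omega> in P. 0 < Z n \<omega>" by (subst (asm) AE_distr_iff) auto
  then show "AE \<omega> in P. 0 \<le> Z n \<omega>" by eventually_elim simp
qed

text \<open>The drawdown event of the static strategy is compared, almost surely and in the
  completion, with the countable cover, which is an event of \<open>P\<close> itself and has the
  same measure there.\<close>

lemma min_drawdown_prob_le:
  assumes xm: "(x, m) \<in> drawdown_domain \<alpha>"
    and L: "((\<lambda>m. v (m, m)) \<longlongrightarrow> L) at_top" "0 \<le> L"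
  shows "min_drawdown_prob P F N Z \<nu> \<alpha> lam \<theta> \<eta> c x m \<le> v (x, m)"
proof -
  let ?U = "\<Union>K. drawdown_cover (x, m) K"
  let ?D = "{\<omega> \<in> space P. drawdown_time \<alpha> (surplus N Z \<nu> lam \<theta> \<eta> c (\<lambda>_ _. R) x) m \<omega> < \<infinity>}"
  interpret PC: prob_space "completion P" by (rule P.prob_space_completion)
  have U: "?U \<in> P.events" by (intro sets.countable_UN) auto
  have "AE \<omega> in P. \<omega> \<in> ?D \<longrightarrow> \<omega> \<in> ?U"
    using AE_counting_path claims_nonneg
  proof eventually_elim
    case (elim \<omega>)
    show ?case
    proof
      assume "\<omega> \<in> ?D"
      then show "\<omega> \<in> ?U" using elim by (intro drawdown_in_cover[OF _ _ _ xm]) auto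
    qed
  qed
  then have "measure (completion P) ?D \<le> measure (completion P) ?U"
    using U by (intro PC.finite_measure_mono_AE AE_completion) auto
  also have "\<dots> = P.prob ?U" using U by simp
  also have "\<dots> \<le> v (x, m)" by (rule drawdown_cover_prob[OF xm L])
  finally have "drawdown_prob P N Z \<nu> \<alpha> lam \<theta> \<eta> c (\<lambda>_ _. R) x m \<le> v (x, m)"
    by (simp add: drawdown_prob_def)
  moreover have "min_drawdown_prob P F N Z \<nu> \<alpha> lam \<theta> \<eta> c x m \<le> drawdown_prob P N Z \<nu> \<alpha> lam \<theta> \<eta> c (\<lambda>_ _. R) x m"
    unfolding min_drawdown_prob_def
  proof (rule cINF_lower)
    show "bdd_below ((\<lambda>R. drawdown_prob P N Z \<nu> \<alpha> lam \<theta> \<eta> c R x m) ` {R. admissible_strategy P F \<nu> lam \<theta> \<eta> c R})"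
      by (rule bdd_belowI2[of _ 0]) (simp add: drawdown_prob_def)
  qed (simp add: static_strategy_admissible)
  ultimately show ?thesis by linarith
qed

end

theorem theorem2p2:
  fixes P :: "'a measure" and F :: "real \<Rightarrow> 'a measure"
    and N :: "real \<Rightarrow> 'a \<Rightarrow> nat" and Z :: "nat \<Rightarrow> 'a \<Rightarrow> real"
    and \<nu> :: "real measure" and \<alpha> lam \<theta> \<eta> c :: real
    and v vx vm :: "real \<times> real \<Rightarrow> real"
  assumes "drawdown_model P F N Z \<nu> \<alpha> lam \<theta> \<eta> c"
    and "C11_on_domain \<alpha> v vx vm"
    and "bounded (v ` {(x, m). 0 \<le> m \<and> x \<le> m})"
    and "\<exists>L\<ge>0. ((\<lambda>m. v (m, m)) \<longlongrightarrow> L) at_top"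
    and "\<And>x m. 0 \<le> m \<Longrightarrow> x < \<alpha> * m \<Longrightarrow> v (x, m) = 1"
    and "\<And>m. 0 \<le> m \<Longrightarrow> vm (m, m) \<le> 0"
    and "\<exists>R. admissible_retention \<nu> lam \<theta> \<eta> c R \<and>
           (\<forall>(x, m) \<in> drawdown_domain \<alpha>. generator \<nu> lam \<theta> \<eta> c R v vx x m \<le> 0)"
  shows "\<forall>(x, m) \<in> drawdown_domain \<alpha>. min_drawdown_prob P F N Z \<nu> \<alpha> lam \<theta> \<eta> c x m \<le> v (x, m)"
proof (intro ballI, clarify)
  fix x m assume xm: "(x, m) \<in> drawdown_domain \<alpha>"
  obtain R where R: "admissible_retention \<nu> lam \<theta> \<eta> c R"
    "\<And>x m. (x, m) \<in> drawdown_domain \<alpha> \<Longrightarrow> generator \<nu> lam \<theta> \<eta> c R v vx x m \<le> 0"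
    using assms(7) by blast
  obtain L where L: "((\<lambda>m. v (m, m)) \<longlongrightarrow> L) at_top" "0 \<le> L" using assms(4) by blast
  interpret drawdown_model P F N Z \<nu> \<alpha> lam \<theta> \<eta> c by (rule assms(1))
  interpret static_verification P F N Z \<nu> \<alpha> lam \<theta> \<eta> c v vx vm R
    by unfold_locales (use assms R in auto)
  show "min_drawdown_prob P F N Z \<nu> \<alpha> lam \<theta> \<eta> c x m \<le> v (x, m)"
    by (rule min_drawdown_prob_le[OF xm L])
qed

end
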